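(* Let $(E,\omega)$ be a modular valuated matroid. Then the projected tropical linear space $\mathcal T(\omega)/\mathbb R\mathbf 1$ is a geometric realization of the Euclidean building associated with the uniform modular lattice $\mathcal L(\omega)$, i.e. of the simplicial complex $\mathcal C(\mathcal L(\omega))$ modulo the equivalence $\simeq$.
   Context: A valuated matroid on a matroid $(E,\mathcal B)$ of finite rank $n$ ($E$ possibly infinite) is $\omega:\mathcal B\to\mathbb R$ such that for $B,B'\in\mathcal B$ and $e\in B\setminus B'$ there is $e'\in B'\setminus B$ with $\omega(B)+\omega(B')\le\omega(B+e'-e)+\omega(B'+e-e')$. For $x\in\mathbb R^E$, $(\omega+x)(B)=\omega(B)+\sum_{e\in B}x(e)$, $\mathcal B_{\omega+x}$ is its set of maximizers over $\mathcal B$, and the tropical linear space is $\mathcal T(\omega):=\{x\in\mathbb R^E:$ the maximum of $\omega+x$ is attained and every $e\in E$ lies in some member of $\mathcal B_{\omega+x}\}$; it is invariant under adding multiples of the all-one vector $\mathbf 1$. For integer-valued $\omega$, $\mathcal L(\omega):=\mathcal T(\omega)\cap\mathbb Z^E$ with the componentwise order is a lattice. A lattice $\mathcal L$ (with no infinite chains in intervals) is modular if $x\wedge(y\vee z)=x\vee(y\wedge z)$ whenever $x\preceq y$; the ascending operator is $(x)^+:=\bigvee\{y:y \text{ covers } x\}$; a uniform modular lattice is a modular lattice in which $(\cdot)^+$ is everywhere defined and is an automorphism. An integer-valued valuated matroid $\omega$ is modular if $\mathcal L(\omega)$ is a uniform modular lattice. $\mathcal C(\mathcal L)$ is the simplicial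 complex of all chains $x^0\prec x^1\prec\cdots\prec x^m$ with $x^m\preceq(x^0)^+$; $x\simeq y$ means $x=(y)^{+k}$ for some $k\in\mathbb Z$ ($(\cdot)^{+k}$ being the $k$-fold iterate, negative $k$ using the inverse). The Euclidean building associated with a uniform modular lattice $\mathcal L$ is $\mathcal C(\mathcal L)$ modulo $\simeq$ (which is a Euclidean building of type A). *)

theory Defs
  imports "HOL-Algebra.Lattice" "HOL-Analysis.Analysis"
begin

section \<open>Uniform modular lattices\<close>

definition covers :: "('a, 'b) gorder_scheme \<Rightarrow> 'a \<Rightarrow> 'a \<Rightarrow> bool" where
  "covers L y x \<longleftrightarrow> x \<in> carrier L \<and> y \<in> carrier L \<and> x \<sqsubset>\<^bsub>L\<^esub> y \<and>
     \<not> (\<exists>z\<in>carrier L. x \<sqsubset>\<^bsub>L\<^esub> z \<and> z \<sqsubset>\<^bsub>L\<^esub> y)"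

definition no_infinite_chains_in_intervals :: "('a, 'b) gorder_scheme \<Rightarrow> bool" where
  "no_infinite_chains_in_intervals L \<longleftrightarrow>
     (\<forall>x\<in>carrier L. \<forall>y\<in>carrier L. \<forall>C \<subseteq> \<lbrace>x..y\<rbrace>\<^bsub>L\<^esub>.
        (\<forall>c\<in>C. \<forall>d\<in>C. c \<sqsubseteq>\<^bsub>L\<^esub> d \<or> d \<sqsubseteq>\<^bsub>L\<^esub> c) \<longrightarrow> finite C)"

definition modular_lattice :: "('a, 'b) gorder_scheme \<Rightarrow> bool" where
  "modular_lattice L \<longleftrightarrow> lattice L \<and> no_infinite_chains_in_intervals L \<and>
     (\<forall>x\<in>carrier L. \<forall>y\<in>carrier L. \<forall>z\<in>carrier L.
        x \<sqsubseteq>\<^bsub>L\<^esub> y \<longrightarrow> y \<sqinter>\<^bsub>L\<^esub> (x \<squnion>\<^bsub>L\<^esub> z) = x \<squnion>\<^bsub>L\<^esub> (y \<sqinter>\<^bsub>L\<^esub> z))"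

definition asc :: "('a, 'b) gorder_scheme \<Rightarrow> 'a \<Rightarrow> 'a" where
  "asc L x = \<Squnion>\<^bsub>L\<^esub> {y. covers L y x}"

definition lattice_automorphism :: "('a, 'b) gorder_scheme \<Rightarrow> ('a \<Rightarrow> 'a) \<Rightarrow> bool" where
  "lattice_automorphism L f \<longleftrightarrow>
     bij_betw f (carrier L) (carrier L) \<and> join_pres L L f \<and> meet_pres L L f"

text \<open>The second conjunct says that \<^const>\<open>asc\<close> is everywhere defined: \<open>\<Squnion>\<close> is a total function in HOL
  and carries information only where the least upper bound exists.\<close>

definition uniform_modular_lattice :: "('a, 'b) gorder_scheme \<Rightarrow> bool" where
  "uniform_modular_lattice L \<longleftrightarrow> modular_lattice L \<and>
     (\<forall>x\<in>carrier L. \<exists>s. least L s (Upper L {y. covers L y x})) \<and>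
     lattice_automorphism L (asc L)"


section \<open>The simplicial complex of short chains and its quotient\<close>

definition asc_power :: "('a, 'b) gorder_scheme \<Rightarrow> int \<Rightarrow> 'a \<Rightarrow> 'a" where
  "asc_power L k x =
     (if 0 \<le> k then (asc L ^^ nat k) x else (inv_into (carrier L) (asc L) ^^ nat (- k)) x)"

definition asc_rel :: "('a, 'b) gorder_scheme \<Rightarrow> 'a rel" where
  "asc_rel L = {(x, y). x \<in> carrier L \<and> y \<in> carrier L \<and> (\<exists>k. x = asc_power L k y)}"

definition chain_complex :: "('a, 'b) gorder_scheme \<Rightarrow> 'a set set" where
  "chain_complex L = {set xs | xs. xs \<noteq> [] \<and> set xs \<subseteq> carrier L \<and>
     sorted_wrt (\<lambda>x y. x \<sqsubset>\<^bsub>L\<^esub> y) xs \<and> last xs \<sqsubseteq>\<^bsub>L\<^esub> asc L (hd xs)}"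

text \<open>The simplices of the quotient complex are the images of the simplices: \<open>S // asc_rel L\<close> is the
  set of classes of the elements of \<open>S\<close>. The vertex set is \<open>\<Union> (euclidean_building L)\<close>.\<close>

definition euclidean_building :: "('a, 'b) gorder_scheme \<Rightarrow> 'a set set set" where
  "euclidean_building L = (\<lambda>S. S // asc_rel L) ` chain_complex L"


section \<open>Geometric realizations\<close>

definition support :: "'v set set \<Rightarrow> ('v \<Rightarrow> real) \<Rightarrow> 'v set" where
  "support K l = {v \<in> \<Union>K. l v \<noteq> 0}"

text \<open>The standard realization \<open>|K|\<close> by barycentric coordinates.\<close>

definition realization :: "'v set set \<Rightarrow> ('v \<Rightarrow> real) set" where
  "realization K = {l \<in> \<Union>K \<rightarrow>\<^sub>E {0..}. support K l \<in> K \<and> (\<Sum>v\<in>support K l. l v) = 1}"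

definition closed_simplex :: "'v set set \<Rightarrow> 'v set \<Rightarrow> ('v \<Rightarrow> real) set" where
  "closed_simplex K \<sigma> = {l \<in> realization K. support K l \<subseteq> \<sigma>}"

text \<open>The topology on \<open>\<Union>\<C>\<close> coherent with the family \<open>\<C>\<close> of subspaces of \<open>X\<close>.\<close>

definition coherent_topology :: "'p topology \<Rightarrow> 'p set set \<Rightarrow> 'p topology" where
  "coherent_topology X \<C> =
     topology (\<lambda>U. U \<subseteq> \<Union>\<C> \<and> (\<forall>C\<in>\<C>. openin (subtopology X C) (U \<inter> C)))"

lemma openin_coherent_topology:
  "openin (coherent_topology X \<C>) U \<longleftrightarrow>
     U \<subseteq> \<Union>\<C> \<and> (\<forall>C\<in>\<C>. openin (subtopology X C) (U \<inter> C))"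
proof -
  have "istopology (\<lambda>U. U \<subseteq> \<Union>\<C> \<and> (\<forall>C\<in>\<C>. openin (subtopology X C) (U \<inter> C)))"
    unfolding istopology_def
  proof (intro conjI allI impI ballI)
    fix S T C
    assume "S \<subseteq> \<Union>\<C> \<and> (\<forall>C\<in>\<C>. openin (subtopology X C) (S \<inter> C))"
      and "T \<subseteq> \<Union>\<C> \<and> (\<forall>C\<in>\<C>. openin (subtopology X C) (T \<inter> C))" and "C \<in> \<C>"
    then have "openin (subtopology X C) ((S \<inter> C) \<inter> (T \<inter> C))"
      by blast
    then show "openin (subtopology X C) (S \<inter> T \<inter> C)"
      by (simp add: Int_ac)
  next
    fix \<K> C
    assume "\<forall>S\<in>\<K>. S \<subseteq> \<Union>\<C> \<and> (\<forall>C\<in>\<C>. openin (subtopology X C) (S \<inter> C))" and "C \<in> \<C>"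
    then have "openin (subtopology X C) (\<Union>S\<in>\<K>. S \<inter> C)"
      by blast
    then show "openin (subtopology X C) (\<Union>\<K> \<inter> C)"
      by (simp add: Int_Union2 Int_commute)
  qed blast+
  then show ?thesis
    by (simp add: coherent_topology_def)
qed

text \<open>A geometric realization of an abstract simplicial complex \<open>K\<close> is a set \<open>T\<close> in a space \<open>X\<close> that is
  decomposed into geometric simplices with vertex scheme \<open>K\<close>. It is given by the map \<open>\<phi>\<close> from \<open>|K|\<close>
  that extends the placement of the vertices affinely. As usual for infinite complexes, \<open>T\<close> carries the
  topology coherent with its closed simplices, each of which has the subspace topology of \<open>X\<close>.
  If \<open>K\<close> is not locally finite, this may be finer than the subspace topology of \<open>T\<close> in \<open>X\<close>.\<close>

definition geometric_realization ::
  "'v set set \<Rightarrow> 'p topology \<Rightarrow> 'p set \<Rightarrow> (('v \<Rightarrow> real) \<Rightarrow> 'p) \<Rightarrow> bool" where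
  "geometric_realization K X T \<phi> \<longleftrightarrow>
     bij_betw \<phi> (realization K) T \<and>
     (\<forall>\<sigma>\<in>K. homeomorphic_map (subtopology (powertop_real (\<Union>K)) (closed_simplex K \<sigma>))
        (subtopology X (\<phi> ` closed_simplex K \<sigma>)) \<phi>) \<and>
     homeomorphic_map (coherent_topology (powertop_real (\<Union>K)) (closed_simplex K ` K))
        (coherent_topology X ((\<lambda>\<sigma>. \<phi> ` closed_simplex K \<sigma>) ` K)) \<phi>"


section \<open>Valuated matroids and tropical linear spaces\<close>

definition matroid_of_rank :: "nat \<Rightarrow> 'a set \<Rightarrow> 'a set set \<Rightarrow> bool" where
  "matroid_of_rank n E \<B> \<longleftrightarrow> \<B> \<noteq> {} \<and>
     (\<forall>B\<in>\<B>. B \<subseteq> E \<and> finite B \<and> card B = n) \<and>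
     (\<forall>B\<in>\<B>. \<forall>B'\<in>\<B>. \<forall>e\<in>B - B'. \<exists>e'\<in>B' - B. insert e' (B - {e}) \<in> \<B>)"

definition valuated_matroid :: "nat \<Rightarrow> 'a set \<Rightarrow> 'a set set \<Rightarrow> ('a set \<Rightarrow> real) \<Rightarrow> bool" where
  "valuated_matroid n E \<B> \<omega> \<longleftrightarrow> matroid_of_rank n E \<B> \<and>
     (\<forall>B\<in>\<B>. \<forall>B'\<in>\<B>. \<forall>e\<in>B - B'. \<exists>e'\<in>B' - B.
        insert e' (B - {e}) \<in> \<B> \<and> insert e (B' - {e'}) \<in> \<B> \<and>
        \<omega> B + \<omega> B' \<le> \<omega> (insert e' (B - {e})) + \<omega> (insert e (B' - {e'})))"

definition maximizers :: "'a set set \<Rightarrow> ('a set \<Rightarrow> real) \<Rightarrow> ('a \<Rightarrow> real) \<Rightarrow> 'a set set" where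
  "maximizers \<B> \<omega> x = {B. is_arg_max (\<lambda>B. \<omega> B + (\<Sum>e\<in>B. x e)) (\<lambda>B. B \<in> \<B>) B}"

text \<open>\<open>\<real>\<^sup>E\<close> is the set \<open>E \<rightarrow>\<^sub>E UNIV\<close> of extensional functions, the carrier of \<open>powertop_real E\<close>.\<close>

definition tropical_linear_space ::
  "'a set \<Rightarrow> 'a set set \<Rightarrow> ('a set \<Rightarrow> real) \<Rightarrow> ('a \<Rightarrow> real) set" where
  "tropical_linear_space E \<B> \<omega> =
     {x \<in> E \<rightarrow>\<^sub>E UNIV. maximizers \<B> \<omega> x \<noteq> {} \<and> (\<forall>e\<in>E. \<exists>B\<in>maximizers \<B> \<omega> x. e \<in> B)}"

definition tropical_lattice ::
  "'a set \<Rightarrow> 'a set set \<Rightarrow> ('a set \<Rightarrow> real) \<Rightarrow> ('a \<Rightarrow> real) gorder" where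
  "tropical_lattice E \<B> \<omega> =
     \<lparr>carrier = {x \<in> tropical_linear_space E \<B> \<omega>. \<forall>e\<in>E. x e \<in> \<int>},
      eq = (=), le = (\<lambda>x y. \<forall>e\<in>E. x e \<le> y e)\<rparr>"

definition modular_valuated_matroid ::
  "nat \<Rightarrow> 'a set \<Rightarrow> 'a set set \<Rightarrow> ('a set \<Rightarrow> real) \<Rightarrow> bool" where
  "modular_valuated_matroid n E \<B> \<omega> \<longleftrightarrow> valuated_matroid n E \<B> \<omega> \<and>
     (\<forall>B\<in>\<B>. \<omega> B \<in> \<int>) \<and> uniform_modular_lattice (tropical_lattice E \<B> \<omega>)"


section \<open>The space \<open>\<real>\<^sup>E/\<real>\<one>\<close>\<close>

definition line_rel :: "'a set \<Rightarrow> ('a \<Rightarrow> real) rel" where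
  "line_rel E = {(x, y). x \<in> E \<rightarrow>\<^sub>E UNIV \<and> y \<in> E \<rightarrow>\<^sub>E UNIV \<and> (\<exists>t. \<forall>e\<in>E. y e = x e + t)}"

definition quotient_topology :: "'p topology \<Rightarrow> 'p rel \<Rightarrow> 'p set topology" where
  "quotient_topology X r = topology (\<lambda>U. U \<subseteq> topspace X // r \<and> openin X (\<Union>U))"

lemma openin_quotient_topology:
  assumes "equiv (topspace X) r"
  shows "openin (quotient_topology X r) U \<longleftrightarrow> U \<subseteq> topspace X // r \<and> openin X (\<Union>U)"
proof -
  have "istopology (\<lambda>U. U \<subseteq> topspace X // r \<and> openin X (\<Union>U))"
    unfolding istopology_def
  proof (intro conjI allI impI)
    fix S T
    assume S: "S \<subseteq> topspace X // r \<and> openin X (\<Union>S)"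
      and T: "T \<subseteq> topspace X // r \<and> openin X (\<Union>T)"
    have "\<Union>(S \<inter> T) = \<Union>S \<inter> \<Union>T"
    proof
      show "\<Union>S \<inter> \<Union>T \<subseteq> \<Union>(S \<inter> T)"
      proof
        fix x assume "x \<in> \<Union>S \<inter> \<Union>T"
        then obtain A B where "A \<in> S" "B \<in> T" "x \<in> A" "x \<in> B" by blast
        moreover have "A = B"
          using quotient_disj[OF assms, of A B] S T calculation by blast
        ultimately show "x \<in> \<Union>(S \<inter> T)" by blast
      qed
    qed blast
    then show "openin X (\<Union>(S \<inter> T))"
      using S T by auto
  next
    fix \<K>
    assume *: "\<forall>S\<in>\<K>. S \<subseteq> topspace X // r \<and> openin X (\<Union>S)"
    have "\<Union>(\<Union>\<K>) = (\<Union>S\<in>\<K>. \<Union>S)" by blast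
    then show "openin X (\<Union>(\<Union>\<K>))"
      using * by auto
  qed blast+
  then show ?thesis
    by (simp add: quotient_topology_def)
qed

lemma equiv_line_rel: "equiv (topspace (powertop_real E)) (line_rel E)"
proof (rule equivI)
  show "line_rel E \<subseteq> topspace (powertop_real E) \<times> topspace (powertop_real E)"
    by (auto simp: line_rel_def)
  show "refl_on (topspace (powertop_real E)) (line_rel E)"
    by (auto simp: refl_on_def line_rel_def intro!: exI[of _ 0])
  show "sym (line_rel E)"
  proof (rule symI)
    fix x y assume "(x, y) \<in> line_rel E"
    then obtain t where "x \<in> E \<rightarrow>\<^sub>E UNIV" "y \<in> E \<rightarrow>\<^sub>E UNIV" "\<forall>e\<in>E. y e = x e + t"
      by (auto simp: line_rel_def)
    then show "(y, x) \<in> line_rel E"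
      by (auto simp: line_rel_def intro!: exI[of _ "- t"])
  qed
  show "trans (line_rel E)"
  proof (rule transI)
    fix x y z assume "(x, y) \<in> line_rel E" "(y, z) \<in> line_rel E"
    then obtain t u where "x \<in> E \<rightarrow>\<^sub>E UNIV" "z \<in> E \<rightarrow>\<^sub>E UNIV"
      "\<forall>e\<in>E. y e = x e + t" "\<forall>e\<in>E. z e = y e + u"
      unfolding line_rel_def by blast
    then show "(x, z) \<in> line_rel E"
      by (auto simp: line_rel_def intro!: exI[of _ "t + u"])
  qed
qed

text \<open>The affine extension to \<open>|K|\<close> of the vertex placement that sends the \<open>\<simeq>\<close>-class of \<open>x\<close> to
  \<open>x + \<real>\<one>\<close>: a point of \<open>\<real>\<^sup>E/\<real>\<one>\<close> is a coset, and \<open>affine_extension E K l\<close> collects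
  \<open>\<Sum>\<^sub>v l v \<cdot> r v + t\<one>\<close> for all scalars \<open>t\<close> and all choices \<open>r\<close> of representatives of the vertices.
  This set is a single coset of \<open>\<real>\<one>\<close> exactly if the value does not depend on the representatives.\<close>

definition affine_extension ::
  "'a set \<Rightarrow> ('a \<Rightarrow> real) set set set \<Rightarrow> (('a \<Rightarrow> real) set \<Rightarrow> real) \<Rightarrow> ('a \<Rightarrow> real) set" where
  "affine_extension E K l =
     {(\<lambda>e\<in>E. (\<Sum>v\<in>support K l. l v * r v e) + t) | r t. \<forall>v\<in>support K l. r v \<in> v}"

end

theory Submission
  imports Defs
begin

text \<open>Every maximizer \<open>B\<close> of \<open>\<omega> + x\<close> is also a maximizer of \<open>\<omega> + \<lfloor>x\<rfloor>\<close>, because an element \<open>e\<close> enters \<open>B\<close>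
  without loss only in exchange for some \<open>a\<close> with \<open>x e - x a \<in> \<int>\<close>. Hence all roundings \<open>\<lfloor>x + t\<rfloor>\<close> of a point
  \<open>x\<close> of the tropical linear space lie in the lattice. For \<open>0 \<le> t < 1\<close> they form a chain of gap at most \<open>\<one>\<close>,
  and \<open>x\<close> is the convex combination of its members weighted by the lengths of the intervals of \<open>t\<close> on
  which they occur. Conversely the members of a chain of gap at most \<open>\<one>\<close> have
  a common maximizer, so their convex combinations stay in the tropical linear space, and the chain and its weights are recovered from
  \<open>t \<mapsto> \<lfloor>x + t\<rfloor>\<close>. Since the ascending operator is \<open>x \<mapsto> x + \<one>\<close>, these chains are the simplices of the
  building once every class modulo \<open>\<int>\<one>\<close> is represented by its member that vanishes at a fixed base
  point of \<open>E\<close>. Closed simplices are compact and \<open>\<real>\<^sup>E/\<real>\<one>\<close> is Hausdorff, which settles the topology.\<close>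

section \<open>Maximizers of an integer-valued valuated matroid\<close>

text \<open>Off \<open>E\<close> both functions take the default value, so the order of
  \<open>\<real>\<^sup>E\<close> is the pointwise order of the function type, and facts about finite
  subsets of ordered types become applicable.\<close>

lemma le_fun_iff_on:
  fixes x y :: "'a \<Rightarrow> real"
  assumes "x \<in> E \<rightarrow>\<^sub>E UNIV" "y \<in> E \<rightarrow>\<^sub>E UNIV"
  shows "(\<forall>e\<in>E. x e \<le> y e) \<longleftrightarrow> x \<le> y"
proof
  assume le: "\<forall>e\<in>E. x e \<le> y e"
  show "x \<le> y"
  proof (rule le_funI)
    fix e show "x e \<le> y e"
      using le PiE_arb[OF assms(1)] PiE_arb[OF assms(2)] by (cases "e \<in> E") auto
  qed
qed (simp add: le_fun_def)

text \<open>The gap to the bound, rounded down to a natural number, has a least value. Since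
  \<open>f\<close> is integral, rounding subtracts the same amount from every gap and so keeps the
  comparison.\<close>

lemma ex_max_on_Ints:
  fixes f :: "'b \<Rightarrow> real"
  assumes "A \<noteq> {}" and int: "\<And>a. a \<in> A \<Longrightarrow> f a \<in> \<int>" and bound: "\<And>a. a \<in> A \<Longrightarrow> f a \<le> M"
  shows "\<exists>a\<in>A. \<forall>b\<in>A. f b \<le> f a"
proof -
  obtain a0 where "a0 \<in> A" using assms(1) by blast
  then obtain a where a: "a \<in> A" and le: "\<And>b. b \<in> A \<Longrightarrow> nat \<lfloor>M - f a\<rfloor> \<le> nat \<lfloor>M - f b\<rfloor>"
    using ex_has_least_nat[of "\<lambda>a. a \<in> A" a0 "\<lambda>a. nat \<lfloor>M - f a\<rfloor>"] by blast
  have "f b \<le> f a" if b: "b \<in> A" for b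
  proof -
    obtain i where i: "f a = of_int i" using int[OF a] by (rule Ints_cases)
    obtain j where j: "f b = of_int j" using int[OF b] by (rule Ints_cases)
    have "0 \<le> \<lfloor>M - f a\<rfloor>" "0 \<le> \<lfloor>M - f b\<rfloor>"
      using bound[OF a] bound[OF that] by simp_all
    then have "\<lfloor>M - f a\<rfloor> \<le> \<lfloor>M - f b\<rfloor>"
      using le[OF that] by linarith
    then have "\<lfloor>M\<rfloor> - i \<le> \<lfloor>M\<rfloor> - j" unfolding i j by simp
    then show ?thesis by (simp add: i j)
  qed
  then show ?thesis using a by blast
qed

lemma Ints_between_0_1:
  fixes d :: real
  assumes "d \<in> \<int>" "0 \<le> d" "d \<le> 1"
  shows "d = 0 \<or> d = 1"
  using assms by (auto elim!: Ints_cases)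

lemma Ints_less_imp_add1_le:
  fixes a b :: real
  assumes "a \<in> \<int>" "b \<in> \<int>" "a < b"
  shows "a + 1 \<le> b"
  using assms by (auto elim!: Ints_cases)

definition shift :: "'a set \<Rightarrow> real \<Rightarrow> ('a \<Rightarrow> real) \<Rightarrow> 'a \<Rightarrow> real" where
  "shift E t x = (\<lambda>e\<in>E. x e + t)"

lemma shift_apply [simp]: "e \<in> E \<Longrightarrow> shift E t x e = x e + t"
  by (simp add: shift_def)

lemma shift_in [simp, intro]: "shift E t x \<in> E \<rightarrow>\<^sub>E UNIV"
  by (simp add: shift_def)

lemma shift_shift [simp]: "shift E s (shift E t x) = shift E (s + t) x"
  by (auto simp: shift_def)

lemma shift_0: "x \<in> E \<rightarrow>\<^sub>E UNIV \<Longrightarrow> shift E 0 x = x"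
  by (auto simp: shift_def PiE_def extensional_def)

section \<open>Exchange and local optimality\<close>

locale integer_valuated_matroid =
  fixes n :: nat and E :: "'a set" and \<B> :: "'a set set" and \<omega> :: "'a set \<Rightarrow> real"
  assumes valuated: "valuated_matroid n E \<B> \<omega>" and integer: "B \<in> \<B> \<Longrightarrow> \<omega> B \<in> \<int>"
begin

abbreviation "M \<equiv> maximizers \<B> \<omega>"
abbreviation "T \<equiv> tropical_linear_space E \<B> \<omega>"
abbreviation "L \<equiv> tropical_lattice E \<B> \<omega>"

lemma basis: "B \<in> \<B> \<Longrightarrow> B \<subseteq> E \<and> finite B \<and> card B = n"
  using valuated by (auto simp: valuated_matroid_def matroid_of_rank_def)

lemma mem_maximizers_iff:
  "B \<in> M x \<longleftrightarrow> B \<in> \<B> \<and> (\<forall>B'\<in>\<B>. \<omega> B' + sum x B' \<le> \<omega> B + sum x B)"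
  by (auto simp: maximizers_def is_arg_max_linorder)

lemma maximizersD: "B \<in> M x \<Longrightarrow> B \<in> \<B>"
  by (simp add: mem_maximizers_iff)

lemma sum_exchange:
  assumes "B \<in> \<B>" "a \<in> B" "e \<notin> B"
  shows "sum x (insert e (B - {a})) = sum x B - x a + (x e :: real)"
proof -
  have "finite B" using basis assms(1) by blast
  then show ?thesis using assms by (simp add: sum_diff1)
qed

text \<open>The exchange axiom seen from the basis that receives \<open>e\<close>: the element
  entering \<open>B\<close> is given, the one leaving it is found.\<close>

lemma exchange:
  assumes "B \<in> \<B>" "B' \<in> \<B>" "e \<in> B' - B"
  obtains a where "a \<in> B - B'" "insert e (B - {a}) \<in> \<B>" "insert a (B' - {e}) \<in> \<B>"
    "\<omega> B + \<omega> B' \<le> \<omega> (insert e (B - {a})) + \<omega> (insert a (B' - {e}))"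
proof -
  obtain a where "a \<in> B - B'" "insert a (B' - {e}) \<in> \<B>" "insert e (B - {a}) \<in> \<B>"
    "\<omega> B' + \<omega> B \<le> \<omega> (insert a (B' - {e})) + \<omega> (insert e (B - {a}))"
    using valuated assms unfolding valuated_matroid_def by blast
  then show thesis using that by (simp add: add.commute)
qed

lemma maximizers_exchange_le:
  assumes "B \<in> M x" "a \<in> B" "e \<notin> B" "insert e (B - {a}) \<in> \<B>"
  shows "\<omega> (insert e (B - {a})) + x e \<le> \<omega> B + x a"
proof -
  have "B \<in> \<B>" using assms(1) by (rule maximizersD)
  moreover have "\<omega> (insert e (B - {a})) + sum x (insert e (B - {a})) \<le> \<omega> B + sum x B"
    using assms(1,4) by (simp add: mem_maximizers_iff)
  ultimately show ?thesis by (simp add: sum_exchange assms)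
qed

lemma maximizers_exchange_mem_iff:
  assumes "B \<in> M x" "a \<in> B" "e \<notin> B" "insert e (B - {a}) \<in> \<B>"
  shows "insert e (B - {a}) \<in> M x \<longleftrightarrow> \<omega> (insert e (B - {a})) + x e = \<omega> B + x a"
proof -
  have B: "B \<in> \<B>" using assms(1) by (rule maximizersD)
  have s: "sum x (insert e (B - {a})) = sum x B - x a + x e"
    using B assms by (simp add: sum_exchange)
  show ?thesis
  proof
    assume "insert e (B - {a}) \<in> M x"
    then have "\<omega> B + sum x B \<le> \<omega> (insert e (B - {a})) + sum x (insert e (B - {a}))"
      using B by (simp add: mem_maximizers_iff)
    then show "\<omega> (insert e (B - {a})) + x e = \<omega> B + x a"
      using maximizers_exchange_le[OF assms] s by simp
  next
    assume "\<omega> (insert e (B - {a})) + x e = \<omega> B + x a"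
    then have "\<omega> (insert e (B - {a})) + sum x (insert e (B - {a})) = \<omega> B + sum x B"
      using s by simp
    then show "insert e (B - {a}) \<in> M x"
      using assms(1,4) by (simp add: mem_maximizers_iff)
  qed
qed

text \<open>Local optimality is global. By the exchange inequality and the local hypothesis, some
  exchange moves \<open>B'\<close> one element closer to \<open>B\<close> without decreasing its
  value.\<close>

lemma maximizersI_local:
  assumes B: "B \<in> \<B>"
    and local: "\<And>a e. a \<in> B \<Longrightarrow> e \<in> E - B \<Longrightarrow> insert e (B - {a}) \<in> \<B> \<Longrightarrow>
      \<omega> (insert e (B - {a})) + x e \<le> \<omega> B + x a"
  shows "B \<in> M x"
proof -
  have "\<omega> B' + sum x B' \<le> \<omega> B + sum x B" if "B' \<in> \<B>" for B'
    using that
  proof (induction "card (B' - B)" arbitrary: B' rule: less_induct)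
    case less
    show ?case
    proof (cases "B' \<subseteq> B")
      case True
      then have "B' = B" using basis B less.prems by (metis card_subset_eq)
      then show ?thesis by simp
    next
      case False
      then obtain e where e: "e \<in> B' - B" by blast
      obtain a where a: "a \<in> B - B'" and B1: "insert e (B - {a}) \<in> \<B>" and B2: "insert a (B' - {e}) \<in> \<B>"
        and le: "\<omega> B + \<omega> B' \<le> \<omega> (insert e (B - {a})) + \<omega> (insert a (B' - {e}))"
        using exchange[OF B less.prems e] by metis
      have "insert a (B' - {e}) - B = (B' - B) - {e}" using a by blast
      then have "card (insert a (B' - {e}) - B) < card (B' - B)"
        using e basis[OF less.prems] by (metis card_Diff1_less finite_Diff)
      then have "\<omega> (insert a (B' - {e})) + sum x (insert a (B' - {e})) \<le> \<omega> B + sum x B"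
        using less.hyps B2 by blast
      moreover have "\<omega> (insert e (B - {a})) + x e \<le> \<omega> B + x a"
        using local a e B1 basis[OF less.prems] by blast
      moreover have "sum x (insert a (B' - {e})) = sum x B' - x e + x a"
        using sum_exchange less.prems a e by simp
      ultimately show ?thesis using le by linarith
    qed
  qed
  then show ?thesis using B by (simp add: mem_maximizers_iff)
qed

text \<open>Optimality bounds each of the two exchanged bases from above, while the exchange
  inequality bounds their sum from below. Hence both bounds are tight, and the maximizers form a
  matroid with symmetric exchange.\<close>

lemma maximizers_exchange:
  assumes "B \<in> M x" "B' \<in> M x" "e \<in> B' - B"
  obtains a where "a \<in> B - B'" "insert e (B - {a}) \<in> M x" "insert a (B' - {e}) \<in> M x"
proof -
  have B: "B \<in> \<B>" "B' \<in> \<B>" using assms maximizersD by auto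
  obtain a where a: "a \<in> B - B'" and B1: "insert e (B - {a}) \<in> \<B>" and B2: "insert a (B' - {e}) \<in> \<B>"
    and le: "\<omega> B + \<omega> B' \<le> \<omega> (insert e (B - {a})) + \<omega> (insert a (B' - {e}))"
    using exchange[OF B assms(3)] by metis
  have "\<omega> (insert e (B - {a})) + x e \<le> \<omega> B + x a"
    "\<omega> (insert a (B' - {e})) + x a \<le> \<omega> B' + x e"
    using maximizers_exchange_le assms a B1 B2 by auto
  then have "\<omega> (insert e (B - {a})) + x e = \<omega> B + x a"
    "\<omega> (insert a (B' - {e})) + x a = \<omega> B' + x e"
    using le by linarith+
  then show ?thesis
    using that a B1 B2 assms maximizers_exchange_mem_iff by auto
qed

lemma tropical_exchange:
  assumes "x \<in> T" "B \<in> M x" "e \<in> E - B"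
  obtains a where "a \<in> B" "insert e (B - {a}) \<in> M x"
proof -
  obtain B' where "B' \<in> M x" "e \<in> B'"
    using assms unfolding tropical_linear_space_def by blast
  then show ?thesis using maximizers_exchange assms that by (metis DiffD1 DiffD2 DiffI)
qed

text \<open>Converse of \<open>tropical_exchange\<close>: membership in the tropical linear space
  can be tested at one maximizer, by the exchanges into it.\<close>

lemma tropicalI:
  assumes "x \<in> E \<rightarrow>\<^sub>E UNIV" "B \<in> M x" "\<And>e. e \<in> E - B \<Longrightarrow> \<exists>a\<in>B. insert e (B - {a}) \<in> M x"
  shows "x \<in> T"
proof -
  have "\<exists>B\<in>M x. e \<in> B" if "e \<in> E" for e
    using assms(2,3) that by (cases "e \<in> B") blast+
  then show ?thesis using assms(1,2) by (auto simp: tropical_linear_space_def)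
qed

section \<open>Translation and rounding in the tropical linear space\<close>

lemma maximizers_shift: "M (shift E t x) = M x"
proof -
  \<comment> \<open>All bases have \<open>n\<close> elements, so every value changes by the same
    constant.\<close>
  have "sum (shift E t x) B = sum x B + real n * t" if "B \<in> \<B>" for B
  proof -
    have "sum (shift E t x) B = (\<Sum>e\<in>B. x e + t)"
      using basis[OF that] by (intro sum.cong) auto
    then show ?thesis using basis[OF that] by (simp add: sum.distrib)
  qed
  then show ?thesis by (auto simp: mem_maximizers_iff)
qed

lemma tropical_shift: "x \<in> T \<Longrightarrow> shift E t x \<in> T"
  by (auto simp: tropical_linear_space_def maximizers_shift)

lemma tropical_PiE: "x \<in> T \<Longrightarrow> x \<in> E \<rightarrow>\<^sub>E UNIV"
  by (simp add: tropical_linear_space_def)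

lemma tropical_maximizer: "x \<in> T \<Longrightarrow> M x \<noteq> {}"
  by (simp add: tropical_linear_space_def)

text \<open>An exchange between two maximizers gives \<open>x e - x a\<close> as a difference of two
  values of \<open>\<omega>\<close>, which is an integer.\<close>

lemma tropical_frac_exchange:
  assumes "x \<in> T" "B \<in> M x" "e \<in> E - B"
  obtains a where "a \<in> B" "insert e (B - {a}) \<in> M x" "x e - x a \<in> \<int>"
proof -
  obtain a where a: "a \<in> B" "insert e (B - {a}) \<in> M x"
    using tropical_exchange assms by blast
  then have "insert e (B - {a}) \<in> \<B>" by (simp add: maximizersD)
  then have "\<omega> (insert e (B - {a})) + x e = \<omega> B + x a"
    using maximizers_exchange_mem_iff assms a by auto
  then have "x e - x a = \<omega> B - \<omega> (insert e (B - {a}))" by linarith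
  then have "x e - x a \<in> \<int>"
    using integer a assms(2) maximizersD by auto
  then show ?thesis using that a by blast
qed

text \<open>Rounding down preserves an inequality \<open>k + x e \<le> x a\<close> with integral
  \<open>k\<close>, so \<open>B\<close> stays locally optimal. Tight exchanges with
  \<open>x e - x a\<close> integral stay tight, because both coordinates lose the same fractional
  part.\<close>

lemma tropical_floor:
  assumes "x \<in> T"
  shows "(\<lambda>e\<in>E. of_int \<lfloor>x e\<rfloor>) \<in> T"
proof -
  let ?y = "\<lambda>e\<in>E. real_of_int \<lfloor>x e\<rfloor>"
  obtain B where B: "B \<in> M x" using tropical_maximizer assms by blast
  then have BB: "B \<in> \<B>" by (rule maximizersD)
  then have sub: "B \<subseteq> E" using basis by blast
  have By: "B \<in> M ?y"
  proof (rule maximizersI_local[OF BB])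
    fix a e assume a: "a \<in> B" and e: "e \<in> E - B" and B': "insert e (B - {a}) \<in> \<B>"
    have "\<omega> (insert e (B - {a})) - \<omega> B \<in> \<int>" using integer BB B' by simp
    then obtain k where k: "\<omega> (insert e (B - {a})) - \<omega> B = of_int k" by (rule Ints_cases)
    have "of_int k + x e \<le> x a"
      using maximizers_exchange_le[OF B a _ B'] e k by simp
    then have "k + \<lfloor>x e\<rfloor> \<le> \<lfloor>x a\<rfloor>"
      by (simp add: le_floor_iff) linarith
    then have "of_int k + ?y e \<le> ?y a" using a e sub by auto
    then show "\<omega> (insert e (B - {a})) + ?y e \<le> \<omega> B + ?y a" using k by linarith
  qed
  show ?thesis
  proof (rule tropicalI[OF _ By])
    fix e assume e: "e \<in> E - B"
    obtain a where a: "a \<in> B" and B': "insert e (B - {a}) \<in> M x" and i: "x e - x a \<in> \<int>"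
      using tropical_frac_exchange[OF assms B e] by blast
    have "\<omega> (insert e (B - {a})) + x e = \<omega> B + x a"
      using maximizers_exchange_mem_iff[OF B a _ maximizersD[OF B']] B' e by simp
    moreover have "?y e - ?y a = x e - x a"
    proof -
      obtain k where "x e - x a = of_int k" using i by (rule Ints_cases)
      then have "x e = x a + of_int k" by simp
      then show ?thesis using a e sub by auto
    qed
    ultimately have "insert e (B - {a}) \<in> M ?y"
      using maximizers_exchange_mem_iff[OF By a _ maximizersD[OF B']] e by simp
    then show "\<exists>a\<in>B. insert e (B - {a}) \<in> M ?y" using a by blast
  qed simp
qed

text \<open>Even for infinite \<open>E\<close>, every fractional part of \<open>x\<close> occurs
  already on a maximizer \<open>B\<close>, which is finite.\<close>

lemma tropical_finite_frac:
  assumes "x \<in> T"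
  shows "finite ((\<lambda>e. frac (x e)) ` E)"
proof -
  obtain B where B: "B \<in> M x" using tropical_maximizer assms by blast
  then have "finite B" using basis maximizersD by blast
  moreover have "(\<lambda>e. frac (x e)) ` E \<subseteq> (\<lambda>e. frac (x e)) ` B"
  proof
    fix f assume "f \<in> (\<lambda>e. frac (x e)) ` E"
    then obtain e where e: "e \<in> E" "f = frac (x e)" by blast
    show "f \<in> (\<lambda>e. frac (x e)) ` B"
    proof (cases "e \<in> B")
      case False
      then obtain a where a: "a \<in> B" "x e - x a \<in> \<int>"
        using tropical_frac_exchange[OF assms B] e by blast
      obtain k where "x e - x a = of_int k" using a(2) by (rule Ints_cases)
      then have "x e = x a + of_int k" by simp
      then have "f = frac (x a)" using e by (simp add: frac_def)
      then show ?thesis using a by blast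
    qed (use e in blast)
  qed
  ultimately show ?thesis by (metis finite_imageI finite_subset)
qed

end

section \<open>Convex combinations of short chains\<close>

text \<open>Comparability with gap at most \<open>\<one>\<close>. Finite nonempty sets of pairwise
  adjacent lattice members are exactly the short chains, so chains can be treated as sets instead of
  lists.\<close>

definition adjacent :: "'a set \<Rightarrow> ('a \<Rightarrow> real) \<Rightarrow> ('a \<Rightarrow> real) \<Rightarrow> bool" where
  "adjacent E x y \<longleftrightarrow>
     (\<forall>e\<in>E. x e \<le> y e \<and> y e \<le> x e + 1) \<or> (\<forall>e\<in>E. y e \<le> x e \<and> x e \<le> y e + 1)"

lemma adjacent_sym: "adjacent E x y \<Longrightarrow> adjacent E y x"
  by (auto simp: adjacent_def)

text \<open>The difference \<open>y - x\<close> takes all its values in \<open>[0, 1]\<close> or all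
  in \<open>[-1, 0]\<close>, so two of them differ by at most 1.\<close>

lemma adjacent_diff_le:
  assumes "adjacent E x y" "a \<in> E" "e \<in> E"
  shows "y a - y e \<le> x a - x e + 1"
  using assms(1) unfolding adjacent_def
proof
  assume le: "\<forall>e\<in>E. x e \<le> y e \<and> y e \<le> x e + 1"
  show ?thesis using bspec[OF le assms(2)] bspec[OF le assms(3)] by linarith
next
  assume le: "\<forall>e\<in>E. y e \<le> x e \<and> x e \<le> y e + 1"
  show ?thesis using bspec[OF le assms(2)] bspec[OF le assms(3)] by linarith
qed

context integer_valuated_matroid
begin

lemma mem_carrier_iff: "x \<in> carrier L \<longleftrightarrow> x \<in> T \<and> (\<forall>e\<in>E. x e \<in> \<int>)"
  by (simp add: tropical_lattice_def)

lemma sum_Ints: "B \<in> \<B> \<Longrightarrow> \<forall>e\<in>E. x e \<in> \<int> \<Longrightarrow> sum x B \<in> \<int>"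
  by (rule Ints_sum) (use basis in auto)

lemma common_maximizer:
  assumes fin: "finite S" and S: "S \<subseteq> carrier L"
    and adj: "\<And>x y. x \<in> S \<Longrightarrow> y \<in> S \<Longrightarrow> adjacent E x y"
  obtains B where "B \<in> \<B>" "\<And>s. s \<in> S \<Longrightarrow> B \<in> M s"
proof -
  \<comment> \<open>A maximizer of the sum of the \<open>\<omega> + s\<close> works: by adjacency and integrality, an exchange that improves
    one summand makes no other summand worse.\<close>
  define W where "W B = (\<Sum>s\<in>S. \<omega> B + sum s B)" for B
  have ne: "\<B> \<noteq> {}" using valuated by (simp add: valuated_matroid_def matroid_of_rank_def)
  have int: "s e \<in> \<int>" if "s \<in> S" "e \<in> E" for s e
    using S that mem_carrier_iff by blast
  have "\<exists>K. \<forall>B\<in>\<B>. \<omega> B + sum s B \<le> K" if s: "s \<in> S" for s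
  proof -
    obtain B where "B \<in> M s" using S s tropical_maximizer mem_carrier_iff by blast
    then show ?thesis unfolding mem_maximizers_iff by blast
  qed
  then obtain K where K: "\<forall>s\<in>S. \<forall>B\<in>\<B>. \<omega> B + sum s B \<le> K s" by metis
  \<comment> \<open>There may be infinitely many bases; the maximum is attained because
    \<open>W\<close> is integral and bounded by the sum of the bounds of its terms.\<close>
  have "\<exists>B\<in>\<B>. \<forall>B'\<in>\<B>. W B' \<le> W B"
  proof (rule ex_max_on_Ints[OF ne])
    fix B assume B: "B \<in> \<B>"
    show "W B \<in> \<int>" unfolding W_def
    proof (rule Ints_sum)
      fix s assume "s \<in> S"
      then have "sum s B \<in> \<int>" using int by (intro sum_Ints[OF B]) blast
      then show "\<omega> B + sum s B \<in> \<int>" using integer[OF B] by simp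
    qed
    show "W B \<le> sum K S" unfolding W_def by (intro sum_mono) (use K B in blast)
  qed
  then obtain B where B: "B \<in> \<B>" and max: "\<And>B'. B' \<in> \<B> \<Longrightarrow> W B' \<le> W B" by blast
  have "B \<in> M s" if s: "s \<in> S" for s
  proof (rule maximizersI_local[OF B])
    fix a e assume a: "a \<in> B" and e: "e \<in> E - B" and B': "insert e (B - {a}) \<in> \<B>"
    let ?B' = "insert e (B - {a})"
    have E: "a \<in> E" "e \<in> E" using a e basis[OF B] by auto
    have val: "sum s' ?B' = sum s' B - s' a + s' e" for s' :: "'a \<Rightarrow> real"
      using sum_exchange[OF B a] e by simp
    show "\<omega> ?B' + s e \<le> \<omega> B + s a"
    proof (rule ccontr)
      assume "\<not> ?thesis"
      then have gt: "\<omega> B + s a < \<omega> ?B' + s e" by simp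
      have gt': "\<omega> B + s a + 1 \<le> \<omega> ?B' + s e"
        by (intro Ints_less_imp_add1_le Ints_add gt integer int B B' s E)
      have "W B < W ?B'" unfolding W_def
      proof (rule sum_strict_mono_ex1[OF fin])
        show "\<forall>s'\<in>S. \<omega> B + sum s' B \<le> \<omega> ?B' + sum s' ?B'"
        proof
          fix s' assume s': "s' \<in> S"
          have "s' a - s' e \<le> s a - s e + 1"
            using adjacent_diff_le[OF adj[OF s s'] E] .
          then show "\<omega> B + sum s' B \<le> \<omega> ?B' + sum s' ?B'" using gt' val[of s'] by linarith
        qed
        show "\<exists>s'\<in>S. \<omega> B + sum s' B < \<omega> ?B' + sum s' ?B'"
          using s gt val[of s] by (intro bexI[of _ s]) auto
      qed
      then show False using max[OF B'] by simp
    qed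
  qed
  then show ?thesis using that B by blast
qed

lemma convex_combination_mem_tropical:
  assumes fin: "finite S" and S: "S \<subseteq> carrier L"
    and adj: "\<And>x y. x \<in> S \<Longrightarrow> y \<in> S \<Longrightarrow> adjacent E x y"
    and pos: "\<And>s. s \<in> S \<Longrightarrow> 0 \<le> w s" and one: "sum w S = 1"
  shows "(\<lambda>e\<in>E. \<Sum>s\<in>S. w s * s e) \<in> T"
proof -
  let ?x = "\<lambda>e\<in>E. \<Sum>s\<in>S. w s * s e"
  have int: "s e \<in> \<int>" if "s \<in> S" "e \<in> E" for s e
    using S that mem_carrier_iff by blast
  have ext: "s \<in> E \<rightarrow>\<^sub>E UNIV" if "s \<in> S" for s
    using S that mem_carrier_iff tropical_PiE by blast
  have "S \<noteq> {}" using one by auto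
  obtain B where B: "B \<in> \<B>" and Bs: "\<And>s. s \<in> S \<Longrightarrow> B \<in> M s"
    using common_maximizer[OF fin S adj] by blast
  \<comment> \<open>Inequalities between values at two coordinates pass from the members of
    \<open>S\<close> to the combination because the weights are nonnegative with sum 1.\<close>
  have comb: "c + ?x e \<le> d + ?x a"
    if "a \<in> E" "e \<in> E" and le: "\<And>s. s \<in> S \<Longrightarrow> c + s e \<le> d + s a" for a e c d
  proof -
    have "(\<Sum>s\<in>S. w s * (c + s e)) \<le> (\<Sum>s\<in>S. w s * (d + s a))"
      by (intro sum_mono mult_left_mono le pos)
    moreover have "(\<Sum>s\<in>S. w s * (c + s e)) = c + ?x e" if "e \<in> E" for c e
      using that by (simp add: distrib_left sum.distrib one flip: sum_distrib_right)
    ultimately show ?thesis using that by simp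
  qed
  have Bx: "B \<in> M ?x"
  proof (rule maximizersI_local[OF B])
    fix a e assume a: "a \<in> B" and e: "e \<in> E - B" and B': "insert e (B - {a}) \<in> \<B>"
    show "\<omega> (insert e (B - {a})) + ?x e \<le> \<omega> B + ?x a"
      using a e basis[OF B] B' by (intro comb maximizers_exchange_le Bs) auto
  qed
  show ?thesis
  proof (rule tropicalI[OF _ Bx])
    fix e assume e: "e \<in> E - B"
    have eE: "e \<in> E" using e by simp
    \<comment> \<open>An exchange that is tight at the largest \<open>s \<in> S\<close> with minimal \<open>s e\<close> is tight at every member of \<open>S\<close>.\<close>
    define P where "P = {s \<in> S. \<forall>s'\<in>S. s e \<le> s' e}"
    have "\<exists>s\<in>S. \<forall>s'\<in>S. s e \<le> s' e"
    proof -
      have "Min ((\<lambda>s. s e) ` S) \<in> (\<lambda>s. s e) ` S" using fin \<open>S \<noteq> {}\<close> by (intro Min_in) auto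
      then obtain s where s: "s \<in> S" "Min ((\<lambda>s. s e) ` S) = s e" by blast
      have "s e \<le> s' e" if "s' \<in> S" for s'
        using Min_le[of "(\<lambda>s. s e) ` S" "s' e"] fin that s(2) by simp
      then show ?thesis using s(1) by blast
    qed
    then have "finite P" "P \<noteq> {}" unfolding P_def using fin by auto
    then obtain m where m: "m \<in> P" and mmax: "\<And>s. s \<in> P \<Longrightarrow> m \<le> s \<Longrightarrow> m = s"
      using finite_has_maximal[of P] by blast
    have mS: "m \<in> S" using m by (simp add: P_def)
    obtain a where a: "a \<in> B" and B'm: "insert e (B - {a}) \<in> M m"
      using tropical_exchange[OF _ Bs[OF mS] e] S mS mem_carrier_iff by blast
    have B': "insert e (B - {a}) \<in> \<B>" using B'm by (rule maximizersD)
    have aE: "a \<in> E" using a basis[OF B] by auto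
    have eqm: "\<omega> (insert e (B - {a})) + m e = \<omega> B + m a"
      using maximizers_exchange_mem_iff[OF Bs[OF mS] a _ B'] e B'm by simp
    have "\<omega> B + s a \<le> \<omega> (insert e (B - {a})) + s e" if s: "s \<in> S" for s
    proof -
      \<comment> \<open>If \<open>s\<close> lies above \<open>m\<close>, then either
        \<open>s = m\<close> by the choice of \<open>m\<close>, or \<open>s\<close> exceeds
        \<open>m\<close> at \<open>e\<close> by 1, the largest possible gap. If \<open>s\<close>
        lies below \<open>m\<close>, minimality of \<open>m e\<close> gives equality at
        \<open>e\<close>.\<close>
      have "s a - m a \<le> s e - m e"
        using adj[OF mS s] unfolding adjacent_def
      proof
        assume le: "\<forall>e\<in>E. m e \<le> s e \<and> s e \<le> m e + 1"
        show ?thesis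
        proof (cases "s e = m e")
          case True
          then have "s \<in> P" using s m by (auto simp: P_def)
          moreover have "m \<le> s"
            using le le_fun_iff_on[OF ext[OF mS] ext[OF s]] by simp
          ultimately have "m = s" by (rule mmax)
          then show ?thesis by simp
        next
          case False
          have "s e - m e \<in> \<int>" using int eE s mS by simp
          then have "s e - m e = 1" using Ints_between_0_1[of "s e - m e"] le eE False by force
          then show ?thesis using le aE by force
        qed
      next
        assume le: "\<forall>e\<in>E. s e \<le> m e \<and> m e \<le> s e + 1"
        then have "s e = m e" using m s eE by (force simp: P_def)
        then show ?thesis using le aE by force
      qed
      then show ?thesis using eqm by linarith
    qed
    then have "\<omega> B + ?x a \<le> \<omega> (insert e (B - {a})) + ?x e"
      by (intro comb aE eE)
    then have "insert e (B - {a}) \<in> M ?x"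
      using maximizers_exchange_mem_iff[OF Bx a _ B'] maximizers_exchange_le[OF Bx a _ B'] e by simp
    then show "\<exists>a\<in>B. insert e (B - {a}) \<in> M ?x" using a by blast
  qed simp
qed

end

section \<open>The ascending operator\<close>

definition raise :: "'a set \<Rightarrow> 'a set \<Rightarrow> ('a \<Rightarrow> real) \<Rightarrow> 'a \<Rightarrow> real" where
  "raise E D x = (\<lambda>e\<in>E. x e + of_bool (e \<in> D))"

lemma raise_apply [simp]: "e \<in> E \<Longrightarrow> raise E D x e = x e + of_bool (e \<in> D)"
  by (simp add: raise_def)

context integer_valuated_matroid
begin

lemma carrier_PiE: "x \<in> carrier L \<Longrightarrow> x \<in> E \<rightarrow>\<^sub>E UNIV"
  by (simp add: mem_carrier_iff tropical_PiE)

lemma carrier_Ints: "x \<in> carrier L \<Longrightarrow> e \<in> E \<Longrightarrow> x e \<in> \<int>"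
  by (simp add: mem_carrier_iff)

lemma lattice_le_iff: "x \<sqsubseteq>\<^bsub>L\<^esub> y \<longleftrightarrow> (\<forall>e\<in>E. x e \<le> y e)"
  by (simp add: tropical_lattice_def)

lemma lattice_eq_iff: "x .=\<^bsub>L\<^esub> y \<longleftrightarrow> x = y"
  by (simp add: tropical_lattice_def)

lemma lattice_less_iff: "x \<sqsubset>\<^bsub>L\<^esub> y \<longleftrightarrow> (\<forall>e\<in>E. x e \<le> y e) \<and> x \<noteq> y"
  by (simp add: lless_def lattice_le_iff lattice_eq_iff)

lemma carrier_shift: "x \<in> carrier L \<Longrightarrow> shift E (of_int k) x \<in> carrier L"
  by (simp add: mem_carrier_iff tropical_shift)

text \<open>By integrality an exchange that is not tight at \<open>x\<close> is worse by at least 1,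
  so raising \<open>e\<close> cannot make it an improvement. A tight one could only improve with
  \<open>e\<close> in \<open>D\<close> and \<open>a\<close> outside, but it would then enlarge the
  intersection with \<open>D\<close>.\<close>

lemma maximizers_raise:
  assumes x: "x \<in> carrier L" and B: "B \<in> M x"
    and max: "\<And>B'. B' \<in> M x \<Longrightarrow> card (B' \<inter> D) \<le> card (B \<inter> D)"
  shows "B \<in> M (raise E D x)"
proof (rule maximizersI_local)
  show BB: "B \<in> \<B>" using B by (rule maximizersD)
  fix a e assume a: "a \<in> B" and e: "e \<in> E - B" and B': "insert e (B - {a}) \<in> \<B>"
  let ?B' = "insert e (B - {a})"
  have E: "a \<in> E" "e \<in> E" using a e basis[OF BB] by auto
  have le: "\<omega> ?B' + x e \<le> \<omega> B + x a"
    using maximizers_exchange_le[OF B a _ B'] e by simp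
  show "\<omega> ?B' + raise E D x e \<le> \<omega> B + raise E D x a"
  proof (cases "\<omega> ?B' + x e = \<omega> B + x a")
    case True
    then have B'x: "?B' \<in> M x" using maximizers_exchange_mem_iff[OF B a _ B'] e by simp
    have "e \<in> D \<Longrightarrow> a \<in> D"
    proof (rule ccontr)
      assume "e \<in> D" "a \<notin> D"
      then have "?B' \<inter> D = insert e (B \<inter> D)" by blast
      then have "card (?B' \<inter> D) = Suc (card (B \<inter> D))"
        using e basis[OF BB] by simp
      then show False using max[OF B'x] by simp
    qed
    then show ?thesis using True E by simp
  next
    case False
    have "\<omega> ?B' + x e + 1 \<le> \<omega> B + x a"
      by (rule Ints_less_imp_add1_le)
        (use False le integer B' BB carrier_Ints[OF x] E in auto)
    then show ?thesis using E by simp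
  qed
qed

text \<open>In the matroid of maximizers, \<open>B\<close> meets \<open>D\<close> in a basis of
  \<open>D\<close>, and \<open>flat\<close> says that no element outside \<open>D\<close> is spanned
  by it. So each \<open>e\<close> has a tight exchange with some \<open>a\<close> on the same side
  of \<open>D\<close>; both coordinates are raised equally and the exchange stays tight.\<close>

lemma raise_mem_carrier:
  assumes x: "x \<in> carrier L" and B: "B \<in> M x"
    and max: "\<And>B'. B' \<in> M x \<Longrightarrow> card (B' \<inter> D) \<le> card (B \<inter> D)"
    and flat: "\<And>e. e \<in> E - B - D \<Longrightarrow> \<exists>a\<in>B - D. insert e (B - {a}) \<in> M x"
  shows "raise E D x \<in> carrier L"
proof -
  have Br: "B \<in> M (raise E D x)" using maximizers_raise[OF x B max] .
  have BB: "B \<in> \<B>" using B by (rule maximizersD)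
  have "raise E D x \<in> T"
  proof (rule tropicalI[OF _ Br])
    fix e assume e: "e \<in> E - B"
    have "\<exists>a\<in>B. insert e (B - {a}) \<in> M x \<and> (a \<in> D \<longleftrightarrow> e \<in> D)"
    proof (cases "e \<in> D")
      case False
      then show ?thesis using flat e by blast
    next
      case True
      obtain a where a: "a \<in> B" and B': "insert e (B - {a}) \<in> M x"
        using tropical_exchange[OF _ B e] x mem_carrier_iff by blast
      have "a \<in> D"
      proof (rule ccontr)
        assume "a \<notin> D"
        then have "insert e (B - {a}) \<inter> D = insert e (B \<inter> D)" using True by blast
        then have "card (insert e (B - {a}) \<inter> D) = Suc (card (B \<inter> D))"
          using e basis[OF BB] by simp
        then show False using max[OF B'] by simp
      qed
      then show ?thesis using a B' True by blast
    qed
    then obtain a where a: "a \<in> B" "insert e (B - {a}) \<in> M x" "a \<in> D \<longleftrightarrow> e \<in> D" by blast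
    have "\<omega> (insert e (B - {a})) + x e = \<omega> B + x a"
      using maximizers_exchange_mem_iff[OF B a(1) _ maximizersD[OF a(2)]] a e by simp
    then have "\<omega> (insert e (B - {a})) + raise E D x e = \<omega> B + raise E D x a"
      using a e basis[OF BB] by (auto simp: subset_iff)
    then have "insert e (B - {a}) \<in> M (raise E D x)"
      using maximizers_exchange_mem_iff[OF Br a(1) _ maximizersD[OF a(2)]] e by simp
    then show "\<exists>a\<in>B. insert e (B - {a}) \<in> M (raise E D x)" using a by blast
  qed (simp add: raise_def)
  then show ?thesis using x by (auto simp: mem_carrier_iff)
qed

lemma ex_maximizer_card_max:
  assumes "x \<in> T"
  obtains B where "B \<in> M x" "\<And>B'. B' \<in> M x \<Longrightarrow> card (B' \<inter> D) \<le> card (B \<inter> D)"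
proof -
  obtain B0 where B0: "B0 \<in> M x" using tropical_maximizer assms by blast
  have "card (B \<inter> D) \<le> n" if "B \<in> M x" for B
    using basis[OF maximizersD[OF that]] by (metis card_mono inf_le1)
  then obtain B where "B \<in> M x" "\<forall>B'. B' \<in> M x \<longrightarrow> card (B' \<inter> D) \<le> card (B \<inter> D)"
    using ex_has_greatest_nat[of "\<lambda>B. B \<in> M x" B0 "\<lambda>B. card (B \<inter> D)" "n + 1"] B0
    by (metis less_Suc_eq_le Suc_eq_plus1)
  then show ?thesis using that by blast
qed

text \<open>For \<open>e\<close> outside the set, exchange \<open>e\<close> between \<open>B\<close>
  and a maximizer of \<open>\<omega> + y\<close> through \<open>e\<close>. Optimality at
  \<open>x\<close> and at \<open>y\<close>, with \<open>x e = y e\<close> and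
  \<open>x a \<le> y a\<close>, forces equality everywhere: the exchange is tight at
  \<open>x\<close> and \<open>a\<close> lies outside the set as well.\<close>

lemma raise_greater_mem_carrier:
  assumes x: "x \<in> carrier L" and y: "y \<in> carrier L" and le: "\<And>e. e \<in> E \<Longrightarrow> x e \<le> y e"
  shows "raise E {e \<in> E. x e < y e} x \<in> carrier L"
proof -
  let ?D = "{e \<in> E. x e < y e}"
  have xT: "x \<in> T" and yT: "y \<in> T" using x y mem_carrier_iff by auto
  obtain B where B: "B \<in> M x" and max: "\<And>B'. B' \<in> M x \<Longrightarrow> card (B' \<inter> ?D) \<le> card (B \<inter> ?D)"
    using ex_maximizer_card_max[OF xT] by metis
  show ?thesis
  proof (rule raise_mem_carrier[OF x B max])
    fix e assume e: "e \<in> E - B - ?D"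
    then have eq: "x e = y e" using le by force
    obtain B' where B': "B' \<in> M y" "e \<in> B'"
      using yT e unfolding tropical_linear_space_def by blast
    obtain a where a: "a \<in> B - B'" and B1: "insert e (B - {a}) \<in> \<B>" and B2: "insert a (B' - {e}) \<in> \<B>"
      and val: "\<omega> B + \<omega> B' \<le> \<omega> (insert e (B - {a})) + \<omega> (insert a (B' - {e}))"
      using exchange[of B B' e] maximizersD[OF B] maximizersD[OF B'(1)] B'(2) e by auto
    have "a \<in> E" using a basis[OF maximizersD[OF B]] by blast
    then have "x a \<le> y a" by (rule le)
    moreover have "\<omega> (insert e (B - {a})) + x e \<le> \<omega> B + x a"
      using maximizers_exchange_le[OF B _ _ B1] a e by simp
    moreover have "\<omega> (insert a (B' - {e})) + y a \<le> \<omega> B' + y e"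
      using maximizers_exchange_le[OF B'(1) B'(2) _ B2] a by simp
    ultimately have "x a = y a" "\<omega> (insert e (B - {a})) + x e = \<omega> B + x a"
      using val eq by linarith+
    then have "a \<notin> ?D" "insert e (B - {a}) \<in> M x"
      using maximizers_exchange_mem_iff[OF B _ _ B1] a e by auto
    then show "\<exists>a\<in>B - ?D. insert e (B - {a}) \<in> M x" using a by blast
  qed
qed

section \<open>Covers and their join\<close>

lemma covers_le_shift:
  assumes "covers L y x" "e \<in> E"
  shows "y e \<le> x e + 1"
proof -
  have x: "x \<in> carrier L" and y: "y \<in> carrier L" and le: "\<forall>e\<in>E. x e \<le> y e" and ne: "x \<noteq> y"
    and cov: "\<And>z. z \<in> carrier L \<Longrightarrow> x \<sqsubset>\<^bsub>L\<^esub> z \<Longrightarrow> \<not> z \<sqsubset>\<^bsub>L\<^esub> y"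
    using assms(1) unfolding covers_def lattice_less_iff by auto
  \<comment> \<open>One unit step on the coordinates where \<open>y\<close> exceeds \<open>x\<close>
    gives a lattice member strictly above \<open>x\<close> and, by integrality, not above
    \<open>y\<close>, so a cover \<open>y\<close> must equal it.\<close>
  let ?D = "{e \<in> E. x e < y e}"
  let ?z = "raise E ?D x"
  have z: "?z \<in> carrier L" using raise_greater_mem_carrier[OF x y] le by blast
  have "\<exists>e\<in>E. x e \<noteq> y e"
    using ne PiE_ext[OF carrier_PiE[OF x] carrier_PiE[OF y]] by blast
  then obtain e' where e': "e' \<in> E" "x e' < y e'" using le by force
  then have "?z e' \<noteq> x e'" by simp
  then have "?z \<noteq> x" by metis
  then have xz: "x \<sqsubset>\<^bsub>L\<^esub> ?z" by (auto simp: lattice_less_iff)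
  have "?z e \<le> y e" if "e \<in> E" for e
  proof (cases "x e < y e")
    case True
    then have "x e + 1 \<le> y e"
      using Ints_less_imp_add1_le carrier_Ints x y that by blast
    then show ?thesis using that True by simp
  qed (use that le in simp)
  then have "?z = y" using cov[OF z xz] by (auto simp: lattice_less_iff)
  then show ?thesis using assms(2) raise_apply[of e E ?D x] by (cases "x e < y e") auto
qed

text \<open>Raising \<open>x\<close> on a flat of rank one gives a cover: an element strictly
  between would raise \<open>x\<close> on a proper nonempty part of a parallel class.\<close>

lemma ex_covers_add1:
  assumes x: "x \<in> carrier L" and e: "e \<in> E"
  obtains y where "covers L y x" "y e = x e + 1"
proof -
  have xT: "x \<in> T" using x mem_carrier_iff by auto
  \<comment> \<open>The parallel class of \<open>e\<close> in the matroid of maximizers of \<open>\<omega> + x\<close>: a flat of rank one.\<close>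
  define D where "D = {f \<in> E. f = e \<or> (\<forall>B\<in>M x. \<not> (e \<in> B \<and> f \<in> B))}"
  have eD: "e \<in> D" and DE: "D \<subseteq> E" using e by (auto simp: D_def)
  have parallel: "f = g" if B: "B \<in> M x" and fg: "f \<in> B \<inter> D" "g \<in> B \<inter> D" for B f g
  proof (rule ccontr)
    assume "f \<noteq> g"
    show False
    proof (cases "e \<in> B")
      case True
      then show False using fg B \<open>f \<noteq> g\<close> by (auto simp: D_def)
    next
      case False
      then obtain a where "a \<in> B" "insert e (B - {a}) \<in> M x"
        using tropical_exchange[OF xT B] e by blast
      \<comment> \<open>Letting \<open>e\<close> into \<open>B\<close> expels at most one of
        \<open>f\<close> and \<open>g\<close>; the other then shares a maximizer with
        \<open>e\<close>, against its membership in \<open>D\<close>.\<close>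
      moreover obtain h where "h \<in> {f, g}" "h \<noteq> a" using \<open>f \<noteq> g\<close> by blast
      ultimately have h: "h \<in> insert e (B - {a})" "h \<in> D" "h \<noteq> e" and B': "insert e (B - {a}) \<in> M x"
        using fg False by auto
      then have "\<forall>B\<in>M x. \<not> (e \<in> B \<and> h \<in> B)" by (simp add: D_def)
      from bspec[OF this B'] show False using h(1) by simp
    qed
  qed
  have card1: "card (B \<inter> D) \<le> 1" if "B \<in> M x" for B
  proof -
    have "finite (B \<inter> D)" using basis[OF maximizersD[OF that]] by blast
    then show ?thesis using parallel[OF that] by (simp add: card_le_Suc0_iff_eq)
  qed
  obtain B where B: "B \<in> M x" and eB: "e \<in> B"
    using xT e unfolding tropical_linear_space_def by blast
  have BD: "B \<inter> D = {e}" using parallel[OF B] eB eD by blast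
  have yC: "raise E D x \<in> carrier L"
  proof (rule raise_mem_carrier[OF x B])
    show "card (B' \<inter> D) \<le> card (B \<inter> D)" if "B' \<in> M x" for B'
      using card1[OF that] BD by simp
    fix g assume g: "g \<in> E - B - D"
    then obtain B' where B': "B' \<in> M x" "e \<in> B'" "g \<in> B'" by (auto simp: D_def)
    then obtain a where a: "a \<in> B - B'" and ex: "insert g (B - {a}) \<in> M x"
      using maximizers_exchange[OF B B'(1), of g] g by blast
    have "a \<noteq> e" using a B'(2) by auto
    then have "a \<in> B - D" using a BD by auto
    then show "\<exists>a\<in>B - D. insert g (B - {a}) \<in> M x" using ex by (rule bexI[rotated])
  qed
  have "raise E D x e \<noteq> x e" using e eD by simp
  then have "raise E D x \<noteq> x" by metis
  then have xy: "x \<sqsubset>\<^bsub>L\<^esub> raise E D x" by (auto simp: lattice_less_iff)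
  have "\<not> z \<sqsubset>\<^bsub>L\<^esub> raise E D x" if z: "z \<in> carrier L" and xz: "x \<sqsubset>\<^bsub>L\<^esub> z" for z
  proof
    assume zy: "z \<sqsubset>\<^bsub>L\<^esub> raise E D x"
    have zT: "z \<in> T" using z mem_carrier_iff by auto
    define D' where "D' = {f \<in> E. x f < z f}"
    have D'z: "z f = x f + of_bool (f \<in> D')" and D'D: "f \<in> D' \<Longrightarrow> f \<in> D" if f: "f \<in> E" for f
    proof -
      have "z f - x f \<in> \<int>" using carrier_Ints x z f by simp
      moreover have "0 \<le> z f - x f" "z f - x f \<le> of_bool (f \<in> D)"
        using xz zy f by (auto simp: lattice_less_iff)
      ultimately have "z f - x f = 0 \<or> f \<in> D \<and> z f - x f = 1"
        using Ints_between_0_1[of "z f - x f"] by (cases "f \<in> D") auto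
      then show "z f = x f + of_bool (f \<in> D')" "f \<in> D' \<Longrightarrow> f \<in> D"
        using f by (auto simp: D'_def)
    qed
    have zraise: "z = raise E D' x"
      by (rule PiE_ext[OF carrier_PiE[OF z]]) (auto simp: D'z raise_def)
    have "\<exists>f\<in>E. x f \<noteq> z f"
      using xz PiE_ext[OF carrier_PiE[OF x] carrier_PiE[OF z]] unfolding lattice_less_iff by blast
    then obtain f where f: "f \<in> D'" "f \<in> E" using D'z by auto
    have "\<exists>g\<in>E. z g \<noteq> raise E D x g"
      using zy PiE_ext[OF carrier_PiE[OF z] carrier_PiE[OF yC]] unfolding lattice_less_iff by blast
    then obtain g where gE: "g \<in> E" and "z g \<noteq> raise E D x g" by blast
    then have "g \<in> D \<and> g \<notin> D'" using D'z[OF gE] D'D[OF gE] by (cases "g \<in> D'") auto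
    then have g: "g \<in> D" "g \<notin> D'" "g \<in> E" using gE by auto
    \<comment> \<open>The contradiction will be a maximizer of \<open>\<omega> + x\<close> that
      contains two parallel elements: some \<open>f'\<close> in \<open>D'\<close>, and
      \<open>g\<close> in \<open>D\<close> but not in \<open>D'\<close>. This \<open>B\<close>
      supplies \<open>f'\<close> and also maximizes \<open>\<omega> + z\<close>.\<close>
    obtain B where B: "B \<in> M x" and max: "\<And>B'. B' \<in> M x \<Longrightarrow> card (B' \<inter> D') \<le> card (B \<inter> D')"
      using ex_maximizer_card_max[OF xT] by metis
    have BB: "B \<in> \<B>" using B by (rule maximizersD)
    have Bz: "B \<in> M z" unfolding zraise by (rule maximizers_raise[OF x B max])
    obtain Bf where Bf: "Bf \<in> M x" "f \<in> Bf"
      using xT f unfolding tropical_linear_space_def by blast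
    have "card (Bf \<inter> D') \<noteq> 0"
      using Bf f basis[OF maximizersD[OF Bf(1)]] by auto
    then have "card (B \<inter> D') \<noteq> 0" using max[OF Bf(1)] by simp
    then obtain f' where f': "f' \<in> B" "f' \<in> D'" by (metis card.empty disjoint_iff)
    have f'E: "f' \<in> E" using f' basis[OF BB] by blast
    have f'D: "f' \<in> D" using D'D f' f'E by blast
    have gB: "g \<notin> B" using parallel[OF B, of f' g] f' f'D g by blast
    obtain a where a: "a \<in> B" and B': "insert g (B - {a}) \<in> M z"
      using tropical_exchange[OF zT Bz, of g] g gB by blast
    have BB': "insert g (B - {a}) \<in> \<B>" using B' by (rule maximizersD)
    have aE: "a \<in> E" using a basis[OF BB] by blast
    have val: "\<omega> (insert g (B - {a})) + z g = \<omega> B + z a"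
      using maximizers_exchange_mem_iff[OF Bz a gB BB'] B' by simp
    have xle: "\<omega> (insert g (B - {a})) + x g \<le> \<omega> B + x a"
      using maximizers_exchange_le[OF B a gB BB'] .
    \<comment> \<open>If \<open>a\<close> were raised from \<open>x\<close> to \<open>z\<close>
      while \<open>g\<close> is not, an exchange tight at \<open>z\<close> would be an improvement
      at \<open>x\<close>. Hence \<open>a\<close> differs from \<open>f'\<close>, and
      \<open>f'\<close> survives the exchange.\<close>
    have aD': "a \<notin> D'" using val xle D'z[OF aE] D'z[OF g(3)] g(2) by auto
    then have "\<omega> (insert g (B - {a})) + x g = \<omega> B + x a"
      using val D'z[OF aE] D'z[OF g(3)] g(2) by simp
    then have "insert g (B - {a}) \<in> M x"
      using maximizers_exchange_mem_iff[OF B a gB BB'] by simp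
    moreover have "f' \<in> insert g (B - {a})" using f' aD' by auto
    ultimately have "f' = g" using parallel[of "insert g (B - {a})" f' g] f'D g by blast
    then show False using f' g by blast
  qed
  then have "covers L (raise E D x) x"
    unfolding covers_def using x yC xy by blast
  then show ?thesis using that e eD by simp
qed

text \<open>All covers lie below \<open>x + \<one>\<close>, and at each coordinate some cover
  reaches it, so this is their least upper bound.\<close>

lemma asc_eq_shift:
  assumes x: "x \<in> carrier L"
  shows "asc L x = shift E 1 x"
proof -
  have s: "shift E 1 x \<in> carrier L" using carrier_shift[OF x, of 1] by simp
  have least_s: "least L (shift E 1 x) (Upper L {y. covers L y x})"
    unfolding least_def
  proof (intro conjI ballI)
    show "Upper L {y. covers L y x} \<subseteq> carrier L" by simp
    show "shift E 1 x \<in> Upper L {y. covers L y x}"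
      using covers_le_shift s by (auto simp: Upper_def lattice_le_iff)
    fix u assume u: "u \<in> Upper L {y. covers L y x}"
    show "shift E 1 x \<sqsubseteq>\<^bsub>L\<^esub> u" unfolding lattice_le_iff
    proof
      fix e assume e: "e \<in> E"
      obtain y where y: "covers L y x" "y e = x e + 1" using ex_covers_add1[OF x e] by blast
      then have "y \<sqsubseteq>\<^bsub>L\<^esub> u" using u by (auto simp: Upper_def covers_def)
      then show "shift E 1 x e \<le> u e" using y e by (auto simp: lattice_le_iff)
    qed
  qed
  \<comment> \<open>The join is defined by choice of a least upper bound, so uniqueness is what
    identifies it.\<close>
  have unique: "z = shift E 1 x" if "least L z (Upper L {y. covers L y x})" for z
  proof (rule PiE_ext)
    have z: "z \<in> carrier L" using that by (auto simp: least_def Upper_def)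
    then show "z \<in> E \<rightarrow>\<^sub>E UNIV" by (rule carrier_PiE)
    show "shift E 1 x \<in> E \<rightarrow>\<^sub>E UNIV" by simp
    have "z \<sqsubseteq>\<^bsub>L\<^esub> shift E 1 x" "shift E 1 x \<sqsubseteq>\<^bsub>L\<^esub> z"
      using that least_s unfolding least_def by blast+
    then show "z e = shift E 1 x e" if "e \<in> E" for e
      using that by (auto simp: lattice_le_iff intro: antisym)
  qed
  show ?thesis
    unfolding asc_def Lattice.sup_def by (intro some_equality least_s unique)
qed

end

section \<open>Recovering a chain and its weights by rounding\<close>

text \<open>Lay intervals of lengths \<open>w s\<close> end to end from 0 in the order of the chain.
  Removing the greatest member \<open>m\<close>, either \<open>t\<close> comes before the last
  interval, where induction applies, or it lies in that interval.\<close>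

lemma chain_position:
  fixes w :: "'p::order \<Rightarrow> real"
  assumes "finite S" and "\<And>x y. x \<in> S \<Longrightarrow> y \<in> S \<Longrightarrow> x \<le> y \<or> y \<le> x"
    and "0 \<le> t" "t < sum w S"
  shows "\<exists>s\<in>S. sum w {s'\<in>S. s' < s} \<le> t \<and> t < sum w {s'\<in>S. s' < s} + w s"
  using assms
proof (induction S rule: finite_psubset_induct)
  case (psubset S)
  have "S \<noteq> {}" using psubset.prems by auto
  then obtain m where m: "m \<in> S" and max: "\<And>s. s \<in> S \<Longrightarrow> m \<le> s \<Longrightarrow> m = s"
    using finite_has_maximal[OF psubset.hyps] by blast
  have below: "{s'\<in>S. s' < m} = S - {m}"
    using max psubset.prems(1)[OF m] by (auto simp: less_le)
  have tot: "sum w S = sum w (S - {m}) + w m"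
    using m psubset.hyps by (simp add: sum.remove)
  show ?case
  proof (cases "t < sum w (S - {m})")
    case True
    have "S - {m} \<subset> S" using m by blast
    then obtain s where s: "s \<in> S - {m}" "sum w {s' \<in> S - {m}. s' < s} \<le> t"
      "t < sum w {s' \<in> S - {m}. s' < s} + w s"
      using psubset.IH[of "S - {m}"] psubset.prems True by auto
    have "{s' \<in> S - {m}. s' < s} = {s' \<in> S. s' < s}"
      using s(1) max by (auto simp: less_le)
    then show ?thesis using s by auto
  next
    case False
    then show ?thesis
      using below tot psubset.prems(3) by (intro bexI[OF _ m]) simp
  qed
qed

text \<open>The weight of \<open>a\<close> is its distance to its predecessor in \<open>A\<close>,
  or to 0 for the least element; the partial sums telescope.\<close>

lemma ex_increment_weights:
  assumes "finite A" and "\<And>a. a \<in> A \<Longrightarrow> 0 < a"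
  shows "\<exists>w :: real \<Rightarrow> real. (\<forall>a\<in>A. 0 < w a) \<and> (\<forall>c\<in>A. (\<Sum>a | a \<in> A \<and> a \<le> c. w a) = c)"
  using assms
proof (induction A rule: finite_linorder_max_induct)
  case empty
  show ?case by simp
next
  case (insert b A)
  then obtain w where pos: "\<forall>a\<in>A. 0 < w a" and eq: "\<forall>c\<in>A. (\<Sum>a | a \<in> A \<and> a \<le> c. w a) = c"
    by auto
  define w' where "w' = w(b := b - sum w A)"
  have bA: "b \<notin> A" using insert.hyps(2) by blast
  have less: "sum w A < b"
  proof (cases "A = {}")
    case True
    then show ?thesis using insert.prems by simp
  next
    case False
    then have MA: "Max A \<in> A" using insert.hyps(1) by simp
    have "{a. a \<in> A \<and> a \<le> Max A} = A" using insert.hyps(1) by auto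
    then have "sum w A = Max A" using eq MA by metis
    then show ?thesis using insert.hyps(2) MA by simp
  qed
  have w'A: "sum w' X = sum w X" if "X \<subseteq> A" for X
    using bA that by (intro sum.cong) (auto simp: w'_def)
  have "(\<Sum>a | a \<in> insert b A \<and> a \<le> c. w' a) = c" if c: "c \<in> insert b A" for c
  proof (cases "c = b")
    case True
    have "{a. a \<in> insert b A \<and> a \<le> c} = insert b A" using True insert.hyps(2) by force
    then have "(\<Sum>a | a \<in> insert b A \<and> a \<le> c. w' a) = w' b + sum w' A"
      using bA insert.hyps(1) by simp
    then show ?thesis using w'A[of A] True by (simp add: w'_def)
  next
    case False
    then have cA: "c \<in> A" using c by simp
    then have "{a. a \<in> insert b A \<and> a \<le> c} = {a. a \<in> A \<and> a \<le> c}" using insert.hyps(2) by force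
    then show ?thesis using w'A[of "{a. a \<in> A \<and> a \<le> c}"] eq cA by simp
  qed
  moreover have "\<forall>a\<in>insert b A. 0 < w' a" using pos less bA by (simp add: w'_def)
  ultimately show ?case by blast
qed

section \<open>Weighted chains and their roundings\<close>

definition combination :: "'a set \<Rightarrow> ('a \<Rightarrow> real) set \<Rightarrow> (('a \<Rightarrow> real) \<Rightarrow> real) \<Rightarrow> 'a \<Rightarrow> real" where
  "combination E S w = (\<lambda>e\<in>E. \<Sum>s\<in>S. w s * s e)"

text \<open>A point in the relative interior of a simplex: the weights are strictly positive, so
  that \<open>S\<close> can be recovered from the point.\<close>

locale weighted_chain =
  fixes E :: "'a set" and S :: "('a \<Rightarrow> real) set" and w :: "('a \<Rightarrow> real) \<Rightarrow> real"
  assumes fin: "finite S"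
    and ext: "\<And>s. s \<in> S \<Longrightarrow> s \<in> E \<rightarrow>\<^sub>E UNIV"
    and int: "\<And>s e. s \<in> S \<Longrightarrow> e \<in> E \<Longrightarrow> s e \<in> \<int>"
    and adj: "\<And>x y. x \<in> S \<Longrightarrow> y \<in> S \<Longrightarrow> adjacent E x y"
    and pos: "\<And>s. s \<in> S \<Longrightarrow> 0 < w s"
    and one: "sum w S = 1"
begin

text \<open>Left end of the interval of shifts at which rounding returns \<open>s\<close>; the
  intervals follow one another in the order of the chain.\<close>

definition offset :: "('a \<Rightarrow> real) \<Rightarrow> real" where
  "offset s = sum w {s'\<in>S. s' < s}"

lemma ext_le: "x \<in> S \<Longrightarrow> y \<in> S \<Longrightarrow> \<forall>e\<in>E. x e \<le> y e \<Longrightarrow> x \<le> y"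
  using le_fun_iff_on[OF ext[of x] ext[of y]] by simp

lemma total: "x \<in> S \<Longrightarrow> y \<in> S \<Longrightarrow> x \<le> y \<or> y \<le> x"
  using adj[of x y] ext_le[of x y] ext_le[of y x] unfolding adjacent_def by auto

lemma offset_nonneg: "0 \<le> offset s"
  unfolding offset_def by (intro sum_nonneg less_imp_le[OF pos]) simp

lemma offset_add_le: "s \<in> S \<Longrightarrow> offset s + w s \<le> 1"
proof -
  assume s: "s \<in> S"
  have "offset s + w s = sum w (insert s {s'\<in>S. s' < s})"
    unfolding offset_def using fin by simp
  also have "\<dots> \<le> sum w S"
    using fin s by (intro sum_mono2 less_imp_le[OF pos]) auto
  finally show ?thesis by (simp add: one)
qed

lemma position:
  assumes "0 \<le> t" "t < 1"
  obtains s where "s \<in> S" "offset s \<le> t" "t < offset s + w s"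
proof -
  have "t < sum w S" using assms(2) one by simp
  then have "\<exists>s\<in>S. offset s \<le> t \<and> t < offset s + w s"
    unfolding offset_def by (intro chain_position fin total assms(1))
  then show thesis using that by blast
qed

text \<open>At the point \<open>x\<close> with barycentric coordinates \<open>w\<close>, the vertex \<open>s\<close> is recovered as the rounding of
  \<open>x + t\<close> for \<open>t\<close> in an interval of length \<open>w s\<close>.\<close>

lemma floor_combination:
  assumes s: "s \<in> S" and t: "offset s \<le> t" "t < offset s + w s" and e: "e \<in> E"
  shows "of_int \<lfloor>combination E S w e + t\<rfloor> = s e"
proof -
  \<comment> \<open>Relative to \<open>s e\<close>, members below \<open>s\<close> lose at most 1
    and members above gain at most 1. Their total weights are \<open>offset s\<close> and
    \<open>1 - offset s - w s\<close>, which confines the combination to the range where rounding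
    after adding \<open>t\<close> gives \<open>s e\<close>.\<close>
  have low: "s e - of_bool (s' < s) \<le> s' e" and high: "s' e \<le> s e + of_bool (s < s')" if s': "s' \<in> S" for s'
    using adj[OF s' s] e ext_le[OF s' s] ext_le[OF s s'] unfolding adjacent_def
    by (auto simp: less_le of_bool_def)
  have indicator: "(\<Sum>s'\<in>S. w s' * of_bool (P s')) = sum w {s'\<in>S. P s'}" for P
    unfolding sum.inter_filter[OF fin] by (intro sum.cong) auto
  have const: "(\<Sum>s'\<in>S. w s' * c) = c" for c
    by (simp add: one flip: sum_distrib_right)
  have "s e - offset s = (\<Sum>s'\<in>S. w s' * (s e - of_bool (s' < s)))"
    unfolding right_diff_distrib sum_subtractf indicator const offset_def by simp
  also have "\<dots> \<le> combination E S w e"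
    using e by (simp add: combination_def, intro sum_mono mult_left_mono low less_imp_le[OF pos])
  finally have 1: "s e - offset s \<le> combination E S w e" .
  have "combination E S w e \<le> (\<Sum>s'\<in>S. w s' * (s e + of_bool (s < s')))"
    using e by (simp add: combination_def, intro sum_mono mult_left_mono high less_imp_le[OF pos])
  also have "\<dots> = s e + sum w {s'\<in>S. s < s'}"
    unfolding distrib_left sum.distrib indicator const by simp
  also have "sum w {s'\<in>S. s < s'} = 1 - offset s - w s"
  proof -
    have "S = {s'\<in>S. s' < s} \<union> insert s {s'\<in>S. s < s'}"
      using s total by (auto simp: less_le)
    then have "sum w S = sum w {s'\<in>S. s' < s} + sum w (insert s {s'\<in>S. s < s'})"
      using fin by (subst sum.union_disjoint[symmetric]) auto
    then show ?thesis using one fin by (simp add: offset_def)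
  qed
  finally have 2: "combination E S w e \<le> s e + 1 - offset s - w s" by simp
  obtain k where k: "s e = of_int k" using int[OF s e] by (rule Ints_cases)
  have "t < 1" using offset_add_le[OF s] t by simp
  then have "\<lfloor>combination E S w e + t\<rfloor> = k"
    using 1 2 t k by (intro floor_unique) auto
  then show ?thesis using k by simp
qed

end

text \<open>For each \<open>t\<close> in \<open>[0, 1)\<close> both chains have a member at position
  \<open>t\<close>, and both members are the rounding of the same point. Hence the chains agree and
  so do their intervals, whose lengths are the weights.\<close>

lemma weighted_chain_unique:
  assumes "weighted_chain E S w" "weighted_chain E S' w'"
    and eq: "combination E S w = combination E S' w'"
  shows "S = S' \<and> (\<forall>s\<in>S. w s = w' s)"
proof -
  interpret A: weighted_chain E S w by (rule assms(1))
  interpret B: weighted_chain E S' w' by (rule assms(2))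
  have same: "s = s'"
    if s: "s \<in> S" "A.offset s \<le> t" "t < A.offset s + w s"
      and s': "s' \<in> S'" "B.offset s' \<le> t" "t < B.offset s' + w' s'" for s s' t
  proof (rule PiE_ext[OF A.ext[OF s(1)] B.ext[OF s'(1)]])
    fix e assume e: "e \<in> E"
    show "s e = s' e"
      using A.floor_combination[OF s e] B.floor_combination[OF s' e] eq by simp
  qed
  have "S \<subseteq> S' \<and> (\<forall>s\<in>S. {A.offset s..<A.offset s + w s} \<subseteq> {B.offset s..<B.offset s + w' s})"
  proof -
    have *: "s \<in> S' \<and> t \<in> {B.offset s..<B.offset s + w' s}"
      if s: "s \<in> S" and t: "t \<in> {A.offset s..<A.offset s + w s}" for s t
    proof -
      have "0 \<le> t" "t < 1"
        using t A.offset_nonneg[of s] A.offset_add_le[OF s] by auto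
      then obtain s' where "s' \<in> S'" "B.offset s' \<le> t" "t < B.offset s' + w' s'"
        using B.position by blast
      then show ?thesis using same[of s t s'] s t by auto
    qed
    have "A.offset s \<in> {A.offset s..<A.offset s + w s}" if "s \<in> S" for s
      using A.pos[OF that] by simp
    then show ?thesis using * by blast
  qed
  moreover have "S' \<subseteq> S \<and> (\<forall>s\<in>S'. {B.offset s..<B.offset s + w' s} \<subseteq> {A.offset s..<A.offset s + w s})"
  proof -
    have *: "s \<in> S \<and> t \<in> {A.offset s..<A.offset s + w s}"
      if s: "s \<in> S'" and t: "t \<in> {B.offset s..<B.offset s + w' s}" for s t
    proof -
      have "0 \<le> t" "t < 1"
        using t B.offset_nonneg[of s] B.offset_add_le[OF s] by auto
      then obtain s' where "s' \<in> S" "A.offset s' \<le> t" "t < A.offset s' + w s'"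
        using A.position by blast
      then show ?thesis using same[of s' t s] s t by auto
    qed
    have "B.offset s \<in> {B.offset s..<B.offset s + w' s}" if "s \<in> S'" for s
      using B.pos[OF that] by simp
    then show ?thesis using * by blast
  qed
  ultimately have SS: "S = S'"
    and iv: "\<And>s. s \<in> S \<Longrightarrow> {A.offset s..<A.offset s + w s} = {B.offset s..<B.offset s + w' s}"
    by blast+
  have "w s = w' s" if s: "s \<in> S" for s
    using iv[OF s] A.pos[OF s] B.pos[of s] s SS
    by (subst (asm) atLeastLessThan_eq_iff) auto
  then show ?thesis using SS by blast
qed

section \<open>The building and its realization\<close>

text \<open>The ambient order is only partial, so the list is built by repeatedly removing a minimal
  element of the chain.\<close>

lemma finite_chain_imp_sorted_list:
  fixes S :: "'p::order set"
  assumes "finite S" "\<And>x y. x \<in> S \<Longrightarrow> y \<in> S \<Longrightarrow> x \<le> y \<or> y \<le> x"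
  shows "\<exists>xs. set xs = S \<and> sorted_wrt (<) xs"
  using assms
proof (induction S rule: finite_psubset_induct)
  case (psubset S)
  show ?case
  proof (cases "S = {}")
    case False
    then obtain m where m: "m \<in> S" and min: "\<And>s. s \<in> S \<Longrightarrow> s \<le> m \<Longrightarrow> m = s"
      using finite_has_minimal[OF psubset.hyps] by blast
    have "S - {m} \<subset> S" using m by blast
    then obtain xs where xs: "set xs = S - {m}" "sorted_wrt (<) xs"
      using psubset.IH[of "S - {m}"] psubset.prems by blast
    have "m < x" if "x \<in> S - {m}" for x
      using min[of x] psubset.prems[of x m] m that by (auto simp: less_le)
    then have "sorted_wrt (<) (m # xs)" using xs by simp
    moreover have "set (m # xs) = S" using xs m by auto
    ultimately show ?thesis by blast
  qed simp
qed

context integer_valuated_matroid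
begin

abbreviation "C \<equiv> carrier L"
abbreviation "K \<equiv> euclidean_building L"

section \<open>The equivalence as translation by integral multiples of the all-one vector\<close>

lemma inv_asc:
  assumes x: "x \<in> C"
  shows "inv_into C (asc L) x = shift E (- 1) x"
proof (rule inv_into_f_eq)
  show "inj_on (asc L) C"
  proof (rule inj_onI)
    fix x y assume x: "x \<in> C" and y: "y \<in> C" and eq: "asc L x = asc L y"
    then have "shift E 1 x = shift E 1 y" by (simp add: asc_eq_shift)
    then have "shift E (- 1) (shift E 1 x) = shift E (- 1) (shift E 1 y)" by simp
    then show "x = y" using carrier_PiE[OF x] carrier_PiE[OF y] by (simp add: shift_0)
  qed
  show *: "shift E (- 1) x \<in> C" using carrier_shift[OF x, of "- 1"] by simp
  show "asc L (shift E (- 1) x) = x"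
    using carrier_PiE[OF x] by (simp add: asc_eq_shift[OF *] shift_0)
qed

lemma asc_power_eq_shift:
  assumes x: "x \<in> C"
  shows "asc_power L k x = shift E (of_int k) x"
proof -
  have up: "(asc L ^^ m) x = shift E (of_nat m) x" for m
  proof (induction m)
    case (Suc m)
    have "shift E (of_nat m) x \<in> C" using carrier_shift[OF x, of "int m"] by simp
    then show ?case by (simp add: Suc asc_eq_shift)
  qed (use carrier_PiE[OF x] in \<open>simp add: shift_0\<close>)
  have down: "(inv_into C (asc L) ^^ m) x = shift E (- of_nat m) x" for m
  proof (induction m)
    case (Suc m)
    have "shift E (- of_nat m) x \<in> C" using carrier_shift[OF x, of "- int m"] by simp
    then show ?case by (simp add: Suc inv_asc)
  qed (use carrier_PiE[OF x] in \<open>simp add: shift_0\<close>)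
  show ?thesis by (simp add: asc_power_def up down)
qed

lemma asc_rel_iff:
  "(x, y) \<in> asc_rel L \<longleftrightarrow> x \<in> C \<and> y \<in> C \<and> (\<exists>k. x = shift E (of_int k) y)"
  by (auto simp: asc_rel_def asc_power_eq_shift)

lemma equiv_asc_rel: "equiv C (asc_rel L)"
proof (rule equivI)
  show "asc_rel L \<subseteq> C \<times> C" by (auto simp: asc_rel_iff)
  show "refl_on C (asc_rel L)"
  proof (rule refl_onI)
    fix x assume x: "x \<in> C"
    then have "x = shift E (of_int 0) x" using carrier_PiE[OF x] by (simp add: shift_0)
    then show "(x, x) \<in> asc_rel L" using x asc_rel_iff by blast
  qed
  show "sym (asc_rel L)"
  proof (rule symI)
    fix x y assume "(x, y) \<in> asc_rel L"
    then obtain k where k: "x \<in> C" "y \<in> C" "x = shift E (of_int k) y" by (auto simp: asc_rel_iff)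
    then have "y = shift E (of_int (- k)) x" using carrier_PiE[OF k(2)] by (simp add: shift_0)
    then show "(y, x) \<in> asc_rel L" using k asc_rel_iff by blast
  qed
  show "trans (asc_rel L)"
  proof (rule transI)
    fix x y z assume "(x, y) \<in> asc_rel L" "(y, z) \<in> asc_rel L"
    then obtain k m where *: "x \<in> C" "z \<in> C" "x = shift E (of_int k) y" "y = shift E (of_int m) z"
      by (auto simp: asc_rel_iff)
    then have "x = shift E (of_int (k + m)) z" by simp
    then show "(x, z) \<in> asc_rel L" using * asc_rel_iff by blast
  qed
qed

definition cls :: "('a \<Rightarrow> real) \<Rightarrow> ('a \<Rightarrow> real) set" where
  "cls x = asc_rel L `` {x}"

lemma cls_eq_iff: "x \<in> C \<Longrightarrow> y \<in> C \<Longrightarrow> cls x = cls y \<longleftrightarrow> (\<exists>k. x = shift E (of_int k) y)"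
  unfolding cls_def using eq_equiv_class_iff[OF equiv_asc_rel] by (simp add: asc_rel_iff)

lemma mem_clsE:
  assumes "r \<in> cls x"
  obtains k :: int where "\<And>e. e \<in> E \<Longrightarrow> r e = x e + of_int k"
proof -
  have "(x, r) \<in> asc_rel L" using assms by (simp add: cls_def)
  then obtain k where "x = shift E (of_int k) r" by (auto simp: asc_rel_iff)
  then have "r e = x e + of_int (- k)" if "e \<in> E" for e using that by simp
  then show thesis by (rule that)
qed

lemma mem_cls: "x \<in> C \<Longrightarrow> x \<in> cls x"
  unfolding cls_def using equiv_class_self[OF equiv_asc_rel] .

text \<open>If \<open>E\<close> is empty, \<open>base\<close> is not in \<open>E\<close>, and \<open>\<real>\<^sup>E\<close> has a single point, which counts as normalized.\<close>

definition base :: 'a where "base = (SOME e. e \<in> E)"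

lemma base_mem: "e \<in> E \<Longrightarrow> base \<in> E"
  unfolding base_def by (rule someI)

section \<open>Normalized representatives of the vertices\<close>

definition normalized :: "('a \<Rightarrow> real) set" where
  "normalized = {x \<in> C. base \<in> E \<longrightarrow> x base = 0}"

lemma normalized_carrier: "normalized \<subseteq> C"
  by (auto simp: normalized_def)

text \<open>If \<open>base\<close> lies in \<open>E\<close>, the value of a lattice member there is
  an integer and the floor only changes its type.\<close>

definition normalize :: "('a \<Rightarrow> real) \<Rightarrow> 'a \<Rightarrow> real" where
  "normalize x = shift E (of_int (- \<lfloor>x base\<rfloor>)) x"

lemma normalize_mem: "x \<in> C \<Longrightarrow> normalize x \<in> normalized"
  unfolding normalized_def
proof (intro CollectI conjI impI)
  assume x: "x \<in> C"
  show "normalize x \<in> C" unfolding normalize_def by (rule carrier_shift[OF x])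
  assume b: "base \<in> E"
  obtain k where "x base = of_int k" using carrier_Ints[OF x b] by (rule Ints_cases)
  then show "normalize x base = 0" using b by (simp add: normalize_def)
qed

lemma cls_normalize: "x \<in> C \<Longrightarrow> cls (normalize x) = cls x"
  using cls_eq_iff[of "normalize x" x] normalize_mem[of x] normalized_carrier
  unfolding normalize_def by blast

lemma inj_on_cls: "inj_on cls normalized"
proof (rule inj_onI)
  fix x y assume x: "x \<in> normalized" and y: "y \<in> normalized" and eq: "cls x = cls y"
  have C: "x \<in> C" "y \<in> C" using x y normalized_carrier by auto
  then obtain k where k: "x = shift E (of_int k) y" using cls_eq_iff eq by blast
  show "x = y"
  proof (rule PiE_ext[OF carrier_PiE[OF C(1)] carrier_PiE[OF C(2)]])
    fix e assume e: "e \<in> E"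
    then have b: "base \<in> E" by (rule base_mem)
    then have "x base = y base + of_int k" using k by simp
    then have "k = 0" using x y b by (simp add: normalized_def)
    then show "x e = y e" using k e by simp
  qed
qed

text \<open>Let \<open>x \<le> y \<le> x + \<one>\<close>. If the values at \<open>base\<close>
  agree, both vectors move by the same amount; if they differ by 1, normalization reverses the
  order, since \<open>y - \<one> \<le> x \<le> y\<close>.\<close>

lemma adjacent_normalize:
  assumes x: "x \<in> C" and y: "y \<in> C" and adj: "adjacent E x y"
  shows "adjacent E (normalize x) (normalize y)"
proof -
  have *: "adjacent E (normalize x) (normalize y)"
    if x: "x \<in> C" and y: "y \<in> C" and le: "\<forall>e\<in>E. x e \<le> y e \<and> y e \<le> x e + 1" for x y
  proof (cases "base \<in> E")
    case False
    then show ?thesis using base_mem by (auto simp: adjacent_def)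
  next
    case True
    obtain i where i: "x base = of_int i" using carrier_Ints[OF x True] by (rule Ints_cases)
    obtain j where j: "y base = of_int j" using carrier_Ints[OF y True] by (rule Ints_cases)
    have "i \<le> j" "j \<le> i + 1" using bspec[OF le True] i j by simp_all
    then consider "j = i" | "j = i + 1" by linarith
    then show ?thesis
    proof cases
      case 1
      then show ?thesis using le i j by (auto simp: adjacent_def normalize_def)
    next
      case 2
      then have "\<forall>e\<in>E. normalize y e \<le> normalize x e \<and> normalize x e \<le> normalize y e + 1"
        using le i j by (auto simp: normalize_def)
      then show ?thesis by (simp add: adjacent_def)
    qed
  qed
  show ?thesis
    using adj *[OF x y] *[OF y x] adjacent_sym unfolding adjacent_def[of E x y] by blast
qed

section \<open>Simplices as finite sets of adjacent vectors\<close>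

lemma chain_complexD:
  assumes "S \<in> chain_complex L"
  shows "finite S" "S \<noteq> {}" "S \<subseteq> C" "\<And>x y. x \<in> S \<Longrightarrow> y \<in> S \<Longrightarrow> adjacent E x y"
proof -
  obtain xs where S: "S = set xs" and ne: "xs \<noteq> []" and sub: "set xs \<subseteq> C"
    and sorted: "sorted_wrt (\<lambda>x y. x \<sqsubset>\<^bsub>L\<^esub> y) xs" and short: "last xs \<sqsubseteq>\<^bsub>L\<^esub> asc L (hd xs)"
    using assms by (auto simp: chain_complex_def)
  show "finite S" "S \<noteq> {}" "S \<subseteq> C" using S ne sub by auto
  have hd: "hd xs e \<le> x e" if "x \<in> set xs" "e \<in> E" for x e
    using that sorted by (cases xs) (auto simp: lattice_less_iff)
  have last: "x e \<le> last xs e" if "x \<in> set xs" "e \<in> E" for x e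
  proof -
    have "sorted_wrt (\<lambda>x y. x \<sqsubset>\<^bsub>L\<^esub> y) (butlast xs @ [last xs])" using sorted ne by simp
    moreover have "x \<in> set (butlast xs @ [last xs])" using that ne by simp
    ultimately show ?thesis using that(2) by (auto simp: sorted_wrt_append lattice_less_iff)
  qed
  have "hd xs \<in> C" using ne sub by (metis hd_in_set subsetD)
  then have short': "last xs e \<le> hd xs e + 1" if "e \<in> E" for e
    using short that by (simp add: asc_eq_shift lattice_le_iff)
  \<comment> \<open>Every member lies between the head of the list and the head plus
    \<open>\<one>\<close>, so any two differ by at most 1 at each coordinate.\<close>
  have gap: "y e \<le> x e + 1" if "x \<in> set xs" "y \<in> set xs" "e \<in> E" for x y e
    using hd[OF that(1,3)] last[OF that(2,3)] short'[OF that(3)] by linarith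
  show "adjacent E x y" if x: "x \<in> S" and y: "y \<in> S" for x y
  proof -
    obtain i j where "i < length xs" "x = xs ! i" "j < length xs" "y = xs ! j"
      using x y S by (metis in_set_conv_nth)
    then consider "x = y" | "x \<sqsubset>\<^bsub>L\<^esub> y" | "y \<sqsubset>\<^bsub>L\<^esub> x"
      using sorted_wrt_nth_less[OF sorted, of i j] sorted_wrt_nth_less[OF sorted, of j i]
        linorder_neqE_nat[of i j] by blast
    then show ?thesis
      using gap x y S by cases (auto simp: adjacent_def lattice_less_iff)
  qed
qed

text \<open>Adjacency makes \<open>S\<close> a finite chain, which can be listed in increasing
  order; adjacency of the two ends gives the bound by the ascending operator.\<close>

lemma chain_complexI:
  assumes fin: "finite S" and ne: "S \<noteq> {}" and sub: "S \<subseteq> C"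
    and adj: "\<And>x y. x \<in> S \<Longrightarrow> y \<in> S \<Longrightarrow> adjacent E x y"
  shows "S \<in> chain_complex L"
proof -
  have le: "x \<le> y \<longleftrightarrow> (\<forall>e\<in>E. x e \<le> y e)" if "x \<in> S" "y \<in> S" for x y
  proof -
    have "x \<in> C" "y \<in> C" using that sub by auto
    then show ?thesis using le_fun_iff_on[OF carrier_PiE carrier_PiE] by blast
  qed
  have "x \<le> y \<or> y \<le> x" if "x \<in> S" "y \<in> S" for x y
    using adj[OF that] le that unfolding adjacent_def by auto
  then obtain xs where xs: "set xs = S" "sorted_wrt (<) xs"
    using finite_chain_imp_sorted_list[OF fin] by blast
  have "xs \<noteq> []" using xs ne by auto
  have hdl: "hd xs \<in> S" "last xs \<in> S" using xs \<open>xs \<noteq> []\<close> by auto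
  have "sorted_wrt (\<lambda>x y. x \<sqsubset>\<^bsub>L\<^esub> y) xs"
    using xs by (intro sorted_wrt_mono_rel[OF _ xs(2)]) (auto simp: lattice_less_iff less_le le)
  moreover have "last xs \<sqsubseteq>\<^bsub>L\<^esub> asc L (hd xs)"
  proof -
    have "hd xs \<in> C" using hdl sub by auto
    moreover have "\<forall>e\<in>E. last xs e \<le> hd xs e + 1"
      using adj[OF hdl] unfolding adjacent_def
      by (intro ballI, elim disjE) (drule bspec, assumption, linarith)+
    ultimately show ?thesis by (simp add: asc_eq_shift lattice_le_iff)
  qed
  ultimately show ?thesis
    unfolding chain_complex_def using xs \<open>xs \<noteq> []\<close> sub by blast
qed

lemma quotient_asc_rel: "S // asc_rel L = cls ` S"
  by (auto simp: quotient_def cls_def)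

text \<open>Normalizing the members of a chain keeps their classes and their adjacency. Simplices of
  the quotient thus become sets of unique representatives.\<close>

lemma building_iff:
  "\<sigma> \<in> K \<longleftrightarrow> (\<exists>S. S \<subseteq> normalized \<and> finite S \<and> S \<noteq> {} \<and> (\<forall>x\<in>S. \<forall>y\<in>S. adjacent E x y) \<and> \<sigma> = cls ` S)"
proof
  assume "\<sigma> \<in> K"
  then obtain S where S: "S \<in> chain_complex L" "\<sigma> = cls ` S"
    by (auto simp: euclidean_building_def quotient_asc_rel)
  note D = chain_complexD[OF S(1)]
  have "cls ` normalize ` S = cls ` S"
    using D(3) cls_normalize by (auto simp: image_image intro!: image_cong)
  moreover have "\<forall>x\<in>normalize ` S. \<forall>y\<in>normalize ` S. adjacent E x y"
    using D(3,4) adjacent_normalize by blast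
  moreover have "normalize ` S \<subseteq> normalized" using D(3) normalize_mem by auto
  ultimately show "\<exists>S. S \<subseteq> normalized \<and> finite S \<and> S \<noteq> {} \<and> (\<forall>x\<in>S. \<forall>y\<in>S. adjacent E x y) \<and> \<sigma> = cls ` S"
    using D(1,2) S(2) by (intro exI[of _ "normalize ` S"]) simp
next
  assume "\<exists>S. S \<subseteq> normalized \<and> finite S \<and> S \<noteq> {} \<and> (\<forall>x\<in>S. \<forall>y\<in>S. adjacent E x y) \<and> \<sigma> = cls ` S"
  then obtain S where S: "S \<subseteq> normalized" "finite S" "S \<noteq> {}" "\<forall>x\<in>S. \<forall>y\<in>S. adjacent E x y" "\<sigma> = cls ` S"
    by blast
  have "S \<in> chain_complex L"
    by (rule chain_complexI) (use S normalized_carrier in auto)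
  then show "\<sigma> \<in> K" unfolding euclidean_building_def quotient_asc_rel S(5) by (rule imageI)
qed

lemma vertices: "\<Union>K = cls ` normalized"
proof
  show "\<Union>K \<subseteq> cls ` normalized"
  proof (rule Union_least)
    fix \<sigma> assume "\<sigma> \<in> K"
    then show "\<sigma> \<subseteq> cls ` normalized" unfolding building_iff by blast
  qed
  show "cls ` normalized \<subseteq> \<Union>K"
  proof
    fix v assume "v \<in> cls ` normalized"
    then obtain x where x: "x \<in> normalized" "v = cls x" by blast
    have "{v} \<in> K" unfolding building_iff
      using x by (intro exI[of _ "{x}"]) (auto simp: adjacent_def)
    then show "v \<in> \<Union>K" by blast
  qed
qed

lemma building_subset: "\<sigma> \<in> K \<Longrightarrow> \<tau> \<subseteq> \<sigma> \<Longrightarrow> \<tau> \<noteq> {} \<Longrightarrow> \<tau> \<in> K"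
proof -
  assume "\<sigma> \<in> K" and \<tau>: "\<tau> \<subseteq> \<sigma>" "\<tau> \<noteq> {}"
  then obtain S where S: "S \<subseteq> normalized" "finite S" "\<forall>x\<in>S. \<forall>y\<in>S. adjacent E x y" "\<sigma> = cls ` S"
    unfolding building_iff by blast
  obtain S' where "S' \<subseteq> S" "\<tau> = cls ` S'" using \<tau>(1) S(4) by (metis subset_imageE)
  then show "\<tau> \<in> K" unfolding building_iff
    using S \<tau>(2) by (intro exI[of _ S']) (auto intro: finite_subset)
qed

text \<open>Other representatives differ from those in \<open>S\<close> by integral multiples of
  \<open>\<one>\<close>, which move the combination only along the line. \<open>S\<close> may exceed
  the support, so that one formula can serve a whole closed simplex.\<close>

lemma affine_extension_eq:
  assumes S: "S \<subseteq> normalized" "finite S" and supp: "support K l \<subseteq> cls ` S"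
    and zero: "\<And>s. s \<in> S \<Longrightarrow> cls s \<notin> support K l \<Longrightarrow> l (cls s) = 0"
  shows "affine_extension E K l = line_rel E `` {combination E S (\<lambda>s. l (cls s))}"
proof -
  let ?c = "combination E S (\<lambda>s. l (cls s))"
  define S' where "S' = {s \<in> S. cls s \<in> support K l}"
  have S'C: "s \<in> C" if "s \<in> S'" for s using that S(1) normalized_carrier by (auto simp: S'_def)
  have supp': "support K l = cls ` S'" using supp by (auto simp: S'_def)
  have inj: "inj_on cls S'" by (rule inj_on_subset[OF inj_on_cls]) (use S(1) in \<open>auto simp: S'_def\<close>)
  have sum: "(\<Sum>v\<in>support K l. l v * r v e) = (\<Sum>s\<in>S'. l (cls s) * r (cls s) e)" for r :: "_ \<Rightarrow> 'a \<Rightarrow> real" and e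
    unfolding supp' by (simp add: sum.reindex[OF inj])
  have c: "?c e = (\<Sum>s\<in>S'. l (cls s) * s e)" if "e \<in> E" for e
  proof -
    have "(\<Sum>s\<in>S. l (cls s) * s e) = (\<Sum>s\<in>S'. l (cls s) * s e)"
      by (rule sum.mono_neutral_right) (use S(2) zero in \<open>auto simp: S'_def\<close>)
    then show ?thesis using that by (simp add: combination_def)
  qed
  show ?thesis
  proof
    show "affine_extension E K l \<subseteq> line_rel E `` {?c}"
    proof
      fix q assume "q \<in> affine_extension E K l"
      then obtain r t where q: "q = (\<lambda>e\<in>E. (\<Sum>v\<in>support K l. l v * r v e) + t)"
        and r: "\<forall>v\<in>support K l. r v \<in> v" by (auto simp: affine_extension_def)
      have "\<exists>k :: int. \<forall>e\<in>E. r (cls s) e = s e + of_int k" if s: "s \<in> S'" for s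
      proof -
        have "r (cls s) \<in> cls s" using r s supp' by blast
        then show ?thesis by (rule mem_clsE) blast
      qed
      then obtain k :: "_ \<Rightarrow> int" where k: "\<forall>s\<in>S'. \<forall>e\<in>E. r (cls s) e = s e + of_int (k s)" by metis
      have "q e = ?c e + ((\<Sum>s\<in>S'. l (cls s) * of_int (k s)) + t)" if e: "e \<in> E" for e
      proof -
        have "(\<Sum>s\<in>S'. l (cls s) * r (cls s) e) = (\<Sum>s\<in>S'. l (cls s) * s e + l (cls s) * of_int (k s))"
          using k e by (intro sum.cong) (auto simp: distrib_left)
        then show ?thesis using e by (simp add: q sum c sum.distrib)
      qed
      moreover have "q \<in> E \<rightarrow>\<^sub>E UNIV" "?c \<in> E \<rightarrow>\<^sub>E UNIV" by (simp_all add: q combination_def)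
      ultimately show "q \<in> line_rel E `` {?c}" unfolding line_rel_def by blast
    qed
    show "line_rel E `` {?c} \<subseteq> affine_extension E K l"
    proof
      fix q assume "q \<in> line_rel E `` {?c}"
      then obtain t where q: "q \<in> E \<rightarrow>\<^sub>E UNIV" "\<forall>e\<in>E. q e = ?c e + t" by (auto simp: line_rel_def)
      define r where "r = the_inv_into S' cls"
      have rs: "r (cls s) = s" if "s \<in> S'" for s
        unfolding r_def using the_inv_into_f_f[OF inj that] .
      have "q = (\<lambda>e\<in>E. (\<Sum>v\<in>support K l. l v * r v e) + t)"
      proof (rule PiE_ext[OF q(1)])
        fix e assume e: "e \<in> E"
        have "(\<Sum>s\<in>S'. l (cls s) * r (cls s) e) = (\<Sum>s\<in>S'. l (cls s) * s e)"
          using rs by (intro sum.cong) auto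
        then show "q e = (\<lambda>e\<in>E. (\<Sum>v\<in>support K l. l v * r v e) + t) e"
          using q(2) e by (simp add: sum c)
      qed simp
      moreover have "\<forall>v\<in>support K l. r v \<in> v"
        unfolding supp' using rs mem_cls S'C by auto
      ultimately show "q \<in> affine_extension E K l" unfolding affine_extension_def by blast
    qed
  qed
qed

section \<open>Injectivity through weighted chains\<close>

lemma realizationE:
  assumes l: "l \<in> realization K"
  obtains S where "S \<subseteq> normalized" "support K l = cls ` S" "weighted_chain E S (\<lambda>s. l (cls s))"
    "affine_extension E K l = line_rel E `` {combination E S (\<lambda>s. l (cls s))}"
proof -
  have supp: "support K l \<in> K" and one: "(\<Sum>v\<in>support K l. l v) = 1" and nonneg: "l \<in> \<Union>K \<rightarrow>\<^sub>E {0..}"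
    using l by (auto simp: realization_def)
  obtain S where S: "S \<subseteq> normalized" "finite S" "\<forall>x\<in>S. \<forall>y\<in>S. adjacent E x y" "support K l = cls ` S"
    using supp unfolding building_iff by blast
  have C: "s \<in> C" if "s \<in> S" for s using that S(1) normalized_carrier by auto
  have "weighted_chain E S (\<lambda>s. l (cls s))"
  proof
    fix s assume s: "s \<in> S"
    then show "s \<in> E \<rightarrow>\<^sub>E UNIV" using C carrier_PiE by blast
    show "e \<in> E \<Longrightarrow> s e \<in> \<int>" for e using C[OF s] carrier_Ints by blast
    have v: "cls s \<in> support K l" using S(4) s by blast
    then have "l (cls s) \<noteq> 0" "cls s \<in> \<Union>K" by (auto simp: support_def)
    then show "0 < l (cls s)" using PiE_mem[OF nonneg, of "cls s"] by simp
  next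
    have "inj_on cls S" using inj_on_subset[OF inj_on_cls S(1)] .
    then show "(\<Sum>s\<in>S. l (cls s)) = 1" using one unfolding S(4) by (simp add: sum.reindex)
  qed (use S in auto)
  moreover have "affine_extension E K l = line_rel E `` {combination E S (\<lambda>s. l (cls s))}"
    by (rule affine_extension_eq) (use S in auto)
  ultimately show thesis using that S by blast
qed

lemma combination_normalized:
  assumes S: "S \<subseteq> normalized" and wc: "weighted_chain E S w"
  shows "combination E S w \<in> T" "base \<in> E \<Longrightarrow> combination E S w base = 0"
proof -
  interpret weighted_chain E S w by (rule wc)
  show "combination E S w \<in> T"
    unfolding combination_def
    by (rule convex_combination_mem_tropical[OF fin _ adj less_imp_le[OF pos] one])
      (use S normalized_carrier in auto)
  show "base \<in> E \<Longrightarrow> combination E S w base = 0"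
    using S by (auto simp: combination_def normalized_def intro!: sum.neutral)
qed

text \<open>A coset of \<open>\<real>\<one>\<close> has at most one member vanishing at
  \<open>base\<close>, so equality of cosets becomes equality of vectors.\<close>

lemma line_rel_normalized_eq:
  assumes "x \<in> E \<rightarrow>\<^sub>E UNIV" "y \<in> E \<rightarrow>\<^sub>E UNIV" "base \<in> E \<Longrightarrow> x base = 0" "base \<in> E \<Longrightarrow> y base = 0"
    and eq: "line_rel E `` {x} = line_rel E `` {y}"
  shows "x = y"
proof (rule PiE_ext[OF assms(1,2)])
  fix e assume e: "e \<in> E"
  then have b: "base \<in> E" by (rule base_mem)
  have "(x, y) \<in> line_rel E"
    using eq_equiv_class[OF eq equiv_line_rel] assms(2) by simp
  then obtain t where t: "\<forall>e\<in>E. y e = x e + t" by (auto simp: line_rel_def)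
  have "t = 0" using bspec[OF t b] assms(3,4)[OF b] by simp
  then show "x e = y e" using t e by simp
qed

lemma inj_on_affine_extension: "inj_on (affine_extension E K) (realization K)"
proof (rule inj_onI)
  fix l l' assume l: "l \<in> realization K" and l': "l' \<in> realization K"
    and eq: "affine_extension E K l = affine_extension E K l'"
  obtain S where S: "S \<subseteq> normalized" "support K l = cls ` S" "weighted_chain E S (\<lambda>s. l (cls s))"
    "affine_extension E K l = line_rel E `` {combination E S (\<lambda>s. l (cls s))}"
    using realizationE[OF l] by blast
  obtain S' where S': "S' \<subseteq> normalized" "support K l' = cls ` S'" "weighted_chain E S' (\<lambda>s. l' (cls s))"
    "affine_extension E K l' = line_rel E `` {combination E S' (\<lambda>s. l' (cls s))}"
    using realizationE[OF l'] by blast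
  have "combination E S (\<lambda>s. l (cls s)) = combination E S' (\<lambda>s. l' (cls s))"
    using combination_normalized[OF S(1,3)] combination_normalized[OF S'(1,3)] eq S(4) S'(4)
    by (intro line_rel_normalized_eq tropical_PiE) auto
  then have *: "S = S'" "\<forall>s\<in>S. l (cls s) = l' (cls s)"
    using weighted_chain_unique[OF S(3) S'(3)] by blast+
  have PiE: "l \<in> \<Union>K \<rightarrow>\<^sub>E {0..}" "l' \<in> \<Union>K \<rightarrow>\<^sub>E {0..}" using l l' by (auto simp: realization_def)
  show "l = l'"
  proof (rule PiE_ext[OF PiE])
    fix v assume v: "v \<in> \<Union>K"
    show "l v = l' v"
    proof (cases "v \<in> cls ` S")
      case True
      then show ?thesis using *(2) by blast
    next
      case False
      then have "v \<notin> support K l" "v \<notin> support K l'" using S(2) S'(2) *(1) by auto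
      then have "l v = 0" "l' v = 0" using v unfolding support_def by blast+
      then show ?thesis by simp
    qed
  qed
qed

section \<open>Surjectivity onto the projected tropical linear space\<close>

lemma ex_realization:
  assumes S: "S \<subseteq> normalized" and wc: "weighted_chain E S w"
  shows "\<exists>l\<in>realization K. affine_extension E K l = line_rel E `` {combination E S w}"
proof -
  interpret weighted_chain E S w by (rule wc)
  have inj: "inj_on cls S" using inj_on_subset[OF inj_on_cls S] .
  define l where "l = (\<lambda>v\<in>\<Union>K. if v \<in> cls ` S then w (the_inv_into S cls v) else 0)"
  have sub: "cls ` S \<subseteq> \<Union>K" using S vertices by auto
  have l: "l (cls s) = w s" if "s \<in> S" for s
    using that sub by (auto simp: l_def the_inv_into_f_f[OF inj])
  have nonneg: "0 \<le> l v" if "v \<in> \<Union>K" for v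
  proof (cases "v \<in> cls ` S")
    case True
    then show ?thesis using l pos by (auto intro: less_imp_le)
  next
    case False
    then show ?thesis using that by (simp add: l_def)
  qed
  have supp: "support K l = cls ` S"
  proof
    show "support K l \<subseteq> cls ` S" unfolding support_def l_def by (auto split: if_splits)
    show "cls ` S \<subseteq> support K l"
    proof
      fix v assume "v \<in> cls ` S"
      then obtain s where s: "s \<in> S" "v = cls s" by blast
      then have "l v \<noteq> 0" using l[OF s(1)] pos[OF s(1)] by simp
      then show "v \<in> support K l" using s sub by (auto simp: support_def)
    qed
  qed
  have "S \<noteq> {}" using one by auto
  have "cls ` S \<in> K" unfolding building_iff using S fin \<open>S \<noteq> {}\<close> adj by blast
  moreover have "(\<Sum>v\<in>cls ` S. l v) = 1"
    using one l by (simp add: sum.reindex[OF inj])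
  moreover have "l \<in> \<Union>K \<rightarrow>\<^sub>E {0..}"
  proof (rule PiE_I)
    show "l v = undefined" if "v \<notin> \<Union>K" for v using that by (simp add: l_def)
  qed (use nonneg in auto)
  ultimately have "l \<in> realization K" by (simp add: realization_def supp)
  moreover have "affine_extension E K l = line_rel E `` {combination E S (\<lambda>s. l (cls s))}"
    by (rule affine_extension_eq) (use S fin supp in auto)
  moreover have "combination E S (\<lambda>s. l (cls s)) = combination E S w"
    unfolding combination_def using l by (auto intro!: restrict_ext sum.cong)
  ultimately show ?thesis by metis
qed

text \<open>Each coordinate is its floor plus its fractional part, and the fractional part is the
  total weight of the thresholds not exceeding it. Grouping by thresholds turns this into a
  combination of roundings of \<open>x\<close>.\<close>

lemma ex_weighted_chain:
  assumes x: "x \<in> T" and b: "base \<in> E \<Longrightarrow> x base = 0"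
  shows "\<exists>S w. S \<subseteq> normalized \<and> weighted_chain E S w \<and> combination E S w = x"
proof -
  \<comment> \<open>Excluding 0 makes all increments positive. The threshold 1 brings the total
    weight to 1 and belongs to the plain floor of \<open>x\<close>.\<close>
  define A where "A = insert 1 ((\<lambda>e. frac (x e)) ` E - {0})"
  have finA: "finite A" using tropical_finite_frac[OF x] by (simp add: A_def)
  have frac: "0 \<le> frac (x e)" "frac (x e) < 1" for e by (simp_all add: frac_lt_1)
  have A: "0 < a" "a \<le> 1" if "a \<in> A" for a
    using that frac by (auto simp: A_def less_le)
  obtain u where pos: "\<forall>a\<in>A. 0 < u a" and incr: "\<forall>c\<in>A. (\<Sum>a | a \<in> A \<and> a \<le> c. u a) = c"
    using ex_increment_weights[OF finA A(1)] by blast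
  have one: "sum u A = 1"
  proof -
    have "{a. a \<in> A \<and> a \<le> 1} = A" using A by auto
    then show ?thesis using incr by (simp add: A_def)
  qed
  \<comment> \<open>On \<open>(0, 1]\<close> the rounding of \<open>x + (1 - a)\<close> changes only at fractional parts \<open>a\<close> of \<open>x\<close>.\<close>
  define y where "y a = (\<lambda>e\<in>E. of_int \<lfloor>x e\<rfloor> + of_bool (a \<le> frac (x e)) :: real)" for a
  have y_floor: "y a = (\<lambda>e\<in>E. of_int \<lfloor>shift E (1 - a) x e\<rfloor>)" if a: "a \<in> A" for a
  proof (rule ext)
    fix e
    have "\<lfloor>x e + (1 - a)\<rfloor> = \<lfloor>x e\<rfloor> + (if a \<le> frac (x e) then 1 else 0)"
    proof -
      have "\<lfloor>of_int i + f + (1 - a)\<rfloor> = i + (if a \<le> f then 1 else 0)" if "0 \<le> f" "f < 1" for i f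
        using A[OF a] that by (intro floor_unique) auto
      from this[OF frac[of e], of "\<lfloor>x e\<rfloor>"] show ?thesis by (simp add: frac_def)
    qed
    then show "y a e = (\<lambda>e\<in>E. of_int \<lfloor>shift E (1 - a) x e\<rfloor>) e" by (simp add: y_def)
  qed
  have yN: "y a \<in> normalized" if a: "a \<in> A" for a
  proof -
    have "y a \<in> T" unfolding y_floor[OF a] by (intro tropical_floor tropical_shift x)
    moreover have "\<forall>e\<in>E. y a e \<in> \<int>" by (simp add: y_def)
    \<comment> \<open>At \<open>base\<close> the fractional part is 0, below every
      threshold.\<close>
    moreover have "y a base = 0" if "base \<in> E" using b[OF that] that A(1)[OF a] by (simp add: y_def)
    ultimately show ?thesis by (simp add: normalized_def mem_carrier_iff)
  qed
  have adj_le: "adjacent E (y a) (y a')" if "a' \<le> a" for a a'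
    using that by (auto simp: adjacent_def y_def)
  have adj: "adjacent E (y a) (y a')" for a a'
    using adj_le[of a' a] adjacent_sym[OF adj_le[of a a']] by linarith
  \<comment> \<open>Collecting weights over the fibres of \<open>y\<close> avoids a separate
    injectivity argument.\<close>
  define w where "w s = (\<Sum>a | a \<in> A \<and> y a = s. u a)" for s
  have "weighted_chain E (y ` A) w"
  proof
    show "finite (y ` A)" using finA by simp
    show "sum w (y ` A) = 1" unfolding w_def using sum.image_gen[OF finA, of u y] one by simp
    fix s assume "s \<in> y ` A"
    then obtain a where a: "a \<in> A" "s = y a" by blast
    show "s \<in> E \<rightarrow>\<^sub>E UNIV" by (simp add: a y_def)
    show "s e \<in> \<int>" if "e \<in> E" for e using that by (simp add: a y_def)
    show "0 < w s" unfolding w_def using finA pos a by (intro sum_pos) auto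
  qed (use adj in auto)
  moreover have "combination E (y ` A) w = x"
  proof (rule PiE_ext[OF _ tropical_PiE[OF x]])
    fix e assume e: "e \<in> E"
    have "(\<Sum>s\<in>y ` A. w s * s e) = (\<Sum>s\<in>y ` A. \<Sum>a | a \<in> A \<and> y a = s. u a * y a e)"
      unfolding w_def sum_distrib_right by (intro sum.cong) auto
    also have "\<dots> = (\<Sum>a\<in>A. u a * y a e)"
      by (rule sum.image_gen[OF finA, symmetric])
    also have "\<dots> = (\<Sum>a\<in>A. u a * of_int \<lfloor>x e\<rfloor> + u a * of_bool (a \<le> frac (x e)))"
      using e by (simp add: y_def distrib_left)
    also have "\<dots> = of_int \<lfloor>x e\<rfloor> + (\<Sum>a\<in>A. u a * of_bool (a \<le> frac (x e)))"
      by (simp add: sum.distrib one flip: sum_distrib_right)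
    also have "(\<Sum>a\<in>A. u a * of_bool (a \<le> frac (x e))) = (\<Sum>a | a \<in> A \<and> a \<le> frac (x e). u a)"
      unfolding sum.inter_filter[OF finA] by (intro sum.cong) auto
    \<comment> \<open>Nonzero fractional parts are thresholds themselves, so \<open>incr\<close>
      applies; for 0 the sum is empty.\<close>
    also have "\<dots> = frac (x e)"
    proof (cases "frac (x e) = 0")
      case True
      then have "\<not> a \<le> frac (x e)" if "a \<in> A" for a using A(1)[OF that] by linarith
      then have "{a. a \<in> A \<and> a \<le> frac (x e)} = {}" by blast
      then show ?thesis by (simp only: True sum.empty)
    next
      case False
      then show ?thesis using incr e by (simp add: A_def)
    qed
    finally show "combination E (y ` A) w e = x e"
      using e by (simp add: combination_def frac_def)
  qed (simp add: combination_def)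
  ultimately show ?thesis using yN by (intro exI[of _ "y ` A"] exI[of _ w]) auto
qed

lemma bij_betw_affine_extension:
  "bij_betw (affine_extension E K) (realization K) (T // line_rel E)"
  unfolding bij_betw_def
proof (intro conjI inj_on_affine_extension equalityI subsetI)
  fix q assume "q \<in> affine_extension E K ` realization K"
  then obtain l where l: "l \<in> realization K" "q = affine_extension E K l" by blast
  obtain S where S: "S \<subseteq> normalized" "weighted_chain E S (\<lambda>s. l (cls s))"
    "affine_extension E K l = line_rel E `` {combination E S (\<lambda>s. l (cls s))}"
    using realizationE[OF l(1)] by metis
  show "q \<in> T // line_rel E"
    unfolding l(2) S(3) using combination_normalized(1)[OF S(1,2)] by (rule quotientI)
next
  fix q assume "q \<in> T // line_rel E"
  then obtain x where x: "x \<in> T" and q: "q = line_rel E `` {x}" by (auto elim: quotientE)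
  \<comment> \<open>The representative on the line through \<open>x\<close> that vanishes at
    \<open>base\<close>.\<close>
  define x0 where "x0 = shift E (- x base) x"
  have x0: "x0 \<in> T" unfolding x0_def by (rule tropical_shift[OF x])
  have "(x, x0) \<in> line_rel E"
    using tropical_PiE[OF x] tropical_PiE[OF x0] by (auto simp: line_rel_def x0_def intro!: exI[of _ "- x base"])
  then have q0: "q = line_rel E `` {x0}" unfolding q by (rule equiv_class_eq[OF equiv_line_rel])
  have "base \<in> E \<Longrightarrow> x0 base = 0" by (simp add: x0_def)
  then obtain S w where "S \<subseteq> normalized" "weighted_chain E S w" "combination E S w = x0"
    using ex_weighted_chain[OF x0] by blast
  then show "q \<in> affine_extension E K ` realization K"
    using ex_realization[of S w] q0 by auto
qed

end

section \<open>Topology\<close>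

text \<open>The preimage of a set of classes under the projection is its union, so the openness
  condition is that of a quotient map.\<close>

lemma quotient_map_quotient_topology:
  assumes "equiv (topspace X) r"
  shows "quotient_map X (quotient_topology X r) (\<lambda>x. r `` {x})"
proof -
  have sub: "openin (quotient_topology X r) U \<longleftrightarrow> U \<subseteq> topspace X // r \<and> openin X (\<Union>U)" for U
    by (rule openin_quotient_topology[OF assms])
  have "openin (quotient_topology X r) (topspace X // r)"
    unfolding sub using Union_quotient[OF assms] by simp
  then have top: "topspace (quotient_topology X r) = topspace X // r"
    using sub openin_subset openin_topspace by (metis subset_antisym)
  have pre: "{x \<in> topspace X. r `` {x} \<in> U} = \<Union>U" if U: "U \<subseteq> topspace X // r" for U
  proof
    show "{x \<in> topspace X. r `` {x} \<in> U} \<subseteq> \<Union>U"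
      using equiv_class_self[OF assms] by blast
    show "\<Union>U \<subseteq> {x \<in> topspace X. r `` {x} \<in> U}"
    proof
      fix x assume "x \<in> \<Union>U"
      then obtain A where A: "A \<in> U" "x \<in> A" by blast
      then have Aq: "A \<in> topspace X // r" using U by blast
      then have x: "x \<in> topspace X" using A(2) Union_quotient[OF assms] by blast
      have "A = r `` {x}"
        using quotient_eqI[OF assms Aq quotientI[OF x] A(2) equiv_class_self[OF assms x]]
          equivE[OF assms] x by (auto dest: refl_onD)
      then show "x \<in> {x \<in> topspace X. r `` {x} \<in> U}" using A x by blast
    qed
  qed
  show ?thesis unfolding quotient_map_def top
  proof (intro conjI allI impI)
    show "(\<lambda>x. r `` {x}) ` topspace X = topspace X // r" by (auto simp: quotient_def)
    fix U assume U: "U \<subseteq> topspace X // r"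
    then show "openin X {x \<in> topspace X. r `` {x} \<in> U} \<longleftrightarrow> openin (quotient_topology X r) U"
      unfolding pre[OF U] sub by blast
  qed
qed

lemma topspace_quotient_topology:
  assumes "equiv (topspace X) r"
  shows "topspace (quotient_topology X r) = topspace X // r"
  using quotient_imp_surjective_map[OF quotient_map_quotient_topology[OF assms]]
  by (auto simp: quotient_def)

lemma Hausdorff_space_if_separated_by_real_maps:
  assumes "\<And>x y. x \<in> topspace X \<Longrightarrow> y \<in> topspace X \<Longrightarrow> x \<noteq> y \<Longrightarrow>
    \<exists>f :: _ \<Rightarrow> real. continuous_map X euclideanreal f \<and> f x \<noteq> f y"
  shows "Hausdorff_space X"
  unfolding Hausdorff_space_def
proof (intro allI impI)
  fix x y assume *: "x \<in> topspace X \<and> y \<in> topspace X \<and> x \<noteq> y"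
  then obtain f :: "_ \<Rightarrow> real" where f: "continuous_map X euclideanreal f" "f x \<noteq> f y"
    using assms by blast
  obtain U V where UV: "open U" "open V" "f x \<in> U" "f y \<in> V" "U \<inter> V = {}"
    using hausdorff[OF f(2)] by blast
  show "\<exists>U V. openin X U \<and> openin X V \<and> x \<in> U \<and> y \<in> V \<and> disjnt U V"
  proof (intro exI conjI)
    show "openin X {z \<in> topspace X. f z \<in> U}" "openin X {z \<in> topspace X. f z \<in> V}"
      using openin_continuous_map_preimage[OF f(1)] UV by (simp_all only: open_openin)
  qed (use * UV in \<open>auto simp: disjnt_def\<close>)
qed

text \<open>Coordinate differences are constant on cosets, descend to continuous functions on the
  quotient, and separate its points.\<close>

lemma Hausdorff_space_line_quotient:
  "Hausdorff_space (quotient_topology (powertop_real E) (line_rel E))"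
proof (rule Hausdorff_space_if_separated_by_real_maps)
  let ?Q = "quotient_topology (powertop_real E) (line_rel E)"
  let ?q = "\<lambda>x. line_rel E `` {x}"
  fix A B assume AB: "A \<in> topspace ?Q" "B \<in> topspace ?Q" "A \<noteq> B"
  obtain x y where x: "x \<in> E \<rightarrow>\<^sub>E UNIV" "A = ?q x" and y: "y \<in> E \<rightarrow>\<^sub>E UNIV" "B = ?q y"
    using AB unfolding topspace_quotient_topology[OF equiv_line_rel] by (auto elim!: quotientE)
  have xy: "(x, y) \<notin> line_rel E"
    using AB(3) x(2) y(2) equiv_class_eq[OF equiv_line_rel] by blast
  have "\<exists>e\<in>E. \<exists>e'\<in>E. x e - x e' \<noteq> y e - y e'"
  proof (rule ccontr)
    assume "\<not> ?thesis"
    then have eq: "x e - x e' = y e - y e'" if "e \<in> E" "e' \<in> E" for e e' using that by blast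
    have "\<exists>t. \<forall>e\<in>E. y e = x e + t"
    proof (cases "E = {}")
      case False
      then obtain e' where e': "e' \<in> E" by blast
      have "\<forall>e\<in>E. y e = x e + (y e' - x e')" using eq[OF _ e'] by force
      then show ?thesis by blast
    qed simp
    then show False using xy x y by (simp add: line_rel_def)
  qed
  then obtain e e' where e: "e \<in> E" "e' \<in> E" "x e - x e' \<noteq> y e - y e'" by blast
  \<comment> \<open>The choice is harmless: all members of a coset have the same difference of
    coordinates.\<close>
  define g where "g A = (SOME d. \<exists>x\<in>A. d = x e - x e')" for A :: "('a \<Rightarrow> real) set"
  have g: "g (?q x) = x e - x e'" if "x \<in> E \<rightarrow>\<^sub>E UNIV" for x
    unfolding g_def
  proof (rule some_equality)
    show "\<exists>z\<in>?q x. x e - x e' = z e - z e'"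
      using equiv_class_self[OF equiv_line_rel, of x E] that by auto
    show "d = x e - x e'" if "\<exists>z\<in>?q x. d = z e - z e'" for d
      using that e by (auto simp: line_rel_def)
  qed
  have "continuous_map (powertop_real E) euclideanreal (\<lambda>x. x e - x e')"
    by (intro continuous_map_diff continuous_map_product_projection e)
  then have "continuous_map (powertop_real E) euclideanreal (g \<circ> ?q)"
    by (rule continuous_map_eq) (simp add: g)
  then have "continuous_map ?Q euclideanreal g"
    using continuous_compose_quotient_map_eq[OF quotient_map_quotient_topology[OF equiv_line_rel]] by blast
  moreover have "g A \<noteq> g B" using e x y g by simp
  ultimately show "\<exists>f :: _ \<Rightarrow> real. continuous_map ?Q euclideanreal f \<and> f A \<noteq> f B" by blast
qed

section \<open>Coherent topologies\<close>

lemma topspace_coherent_topology: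
  assumes "\<And>C. C \<in> \<C> \<Longrightarrow> C \<subseteq> topspace X"
  shows "topspace (coherent_topology X \<C>) = \<Union>\<C>"
proof
  show "topspace (coherent_topology X \<C>) \<subseteq> \<Union>\<C>"
    using openin_topspace[of "coherent_topology X \<C>"] unfolding openin_coherent_topology by blast
  have "openin (coherent_topology X \<C>) (\<Union>\<C>)"
    unfolding openin_coherent_topology
  proof (intro conjI ballI)
    fix C assume C: "C \<in> \<C>"
    then have "\<Union>\<C> \<inter> C = topspace (subtopology X C)" using assms[OF C] by auto
    then show "openin (subtopology X C) (\<Union>\<C> \<inter> C)" by (metis openin_topspace)
  qed simp
  then show "\<Union>\<C> \<subseteq> topspace (coherent_topology X \<C>)" by (rule openin_subset)
qed

text \<open>Openness is tested piece by piece, and by injectivity the trace of \<open>f\<close>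
  U\<open>on\<close>f \<open>F k\<close> is the image of the trace of \<open>U\<close> on
  \<open>F k\<close>.\<close>

lemma homeomorphic_map_coherent_topology:
  assumes inj: "inj_on f (\<Union>(F ` K))"
    and X: "\<And>k. k \<in> K \<Longrightarrow> F k \<subseteq> topspace X" and Y: "\<And>k. k \<in> K \<Longrightarrow> f ` F k \<subseteq> topspace Y"
    and hom: "\<And>k. k \<in> K \<Longrightarrow> homeomorphic_map (subtopology X (F k)) (subtopology Y (f ` F k)) f"
  shows "homeomorphic_map (coherent_topology X (F ` K)) (coherent_topology Y ((\<lambda>k. f ` F k) ` K)) f"
    (is "homeomorphic_map ?X ?Y f")
proof -
  have topX: "topspace ?X = \<Union>(F ` K)" by (rule topspace_coherent_topology) (use X in auto)
  have topY: "topspace ?Y = \<Union>((\<lambda>k. f ` F k) ` K)" by (rule topspace_coherent_topology) (use Y in auto)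
  have open_iff: "openin (subtopology Y (f ` F k)) (f ` U \<inter> f ` F k) \<longleftrightarrow> openin (subtopology X (F k)) (U \<inter> F k)"
    if k: "k \<in> K" and U: "U \<subseteq> \<Union>(F ` K)" for k U
  proof -
    have "f ` U \<inter> f ` F k = f ` (U \<inter> F k)"
      using inj_on_image_Int[OF inj U, of "F k"] k by blast
    moreover have "U \<inter> F k \<subseteq> topspace (subtopology X (F k))" using X[OF k] by auto
    ultimately show ?thesis using homeomorphic_map_openness[OF hom[OF k]] by metis
  qed
  have open_image: "openin ?Y (f ` U) \<longleftrightarrow> openin ?X U" if U: "U \<subseteq> \<Union>(F ` K)" for U
  proof -
    have "f ` U \<subseteq> \<Union>((\<lambda>k. f ` F k) ` K)" using U by blast
    then show ?thesis using open_iff[OF _ U] U unfolding openin_coherent_topology by simp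
  qed
  show ?thesis
    unfolding homeomorphic_map_def quotient_map_def topX topY
  proof (intro conjI inj allI impI)
    show img: "f ` \<Union>(F ` K) = \<Union>((\<lambda>k. f ` F k) ` K)" by blast
    fix V assume V: "V \<subseteq> \<Union>((\<lambda>k. f ` F k) ` K)"
    let ?U = "{x. x \<in> \<Union>(F ` K) \<and> f x \<in> V}"
    have "f ` ?U = V" using V img by blast
    then show "openin ?X ?U \<longleftrightarrow> openin ?Y V" using open_image[of ?U] by auto
  qed
qed

section \<open>Compactness of closed simplices\<close>

lemma closed_simplex_eq:
  assumes \<sigma>: "\<sigma> \<in> K" "finite \<sigma>" and sub: "\<And>\<tau>. \<tau> \<subseteq> \<sigma> \<Longrightarrow> \<tau> \<noteq> {} \<Longrightarrow> \<tau> \<in> K"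
  shows "closed_simplex K \<sigma> =
    {l \<in> \<Union>K \<rightarrow>\<^sub>E UNIV. (\<Sum>v\<in>\<sigma>. l v) \<in> {1}} \<inter> (\<Pi>\<^sub>E v\<in>\<Union>K. if v \<in> \<sigma> then {0..1} else {0})"
    (is "_ = ?A \<inter> ?B")
proof
  have sum: "(\<Sum>v\<in>support K l. l v) = (\<Sum>v\<in>\<sigma>. l v)" if "support K l \<subseteq> \<sigma>" for l :: "_ \<Rightarrow> real"
    by (rule sum.mono_neutral_left) (use that \<sigma> in \<open>auto simp: support_def\<close>)
  show "closed_simplex K \<sigma> \<subseteq> ?A \<inter> ?B"
  proof
    fix l assume "l \<in> closed_simplex K \<sigma>"
    then have l: "l \<in> \<Union>K \<rightarrow>\<^sub>E {0..}" "(\<Sum>v\<in>support K l. l v) = 1" "support K l \<subseteq> \<sigma>"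
      by (auto simp: closed_simplex_def realization_def)
    have one: "(\<Sum>v\<in>\<sigma>. l v) = 1" using sum[OF l(3)] l(2) by simp
    have nonneg: "0 \<le> l v" if "v \<in> \<Union>K" for v using PiE_mem[OF l(1) that] by simp
    have "l v \<in> (if v \<in> \<sigma> then {0..1} else {0})" if v: "v \<in> \<Union>K" for v
    proof (cases "v \<in> \<sigma>")
      case True
      have "l v \<le> (\<Sum>v\<in>\<sigma>. l v)"
        using True \<sigma> nonneg by (intro member_le_sum) auto
      then show ?thesis using True nonneg[OF v] one by simp
    next
      case False
      then have "v \<notin> support K l" using l(3) by blast
      then have "l v = 0" using v unfolding support_def by blast
      then show ?thesis using False by simp
    qed
    moreover have "l v = undefined" if "v \<notin> \<Union>K" for v using PiE_arb[OF l(1) that] .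
    ultimately show "l \<in> ?A \<inter> ?B" using one by (auto intro!: PiE_I)
  qed
  show "?A \<inter> ?B \<subseteq> closed_simplex K \<sigma>"
  proof
    fix l assume l: "l \<in> ?A \<inter> ?B"
    then have one: "(\<Sum>v\<in>\<sigma>. l v) = 1" and B: "l \<in> ?B" by auto
    have lv: "l v \<in> (if v \<in> \<sigma> then {0..1} else {0})" if "v \<in> \<Union>K" for v
      using PiE_mem[OF B that] .
    have supp: "support K l \<subseteq> \<sigma>"
    proof
      fix v assume "v \<in> support K l"
      then have "v \<in> \<Union>K" "l v \<noteq> 0" by (auto simp: support_def)
      then show "v \<in> \<sigma>" using lv[of v] by (auto split: if_splits)
    qed
    have "support K l \<noteq> {}" using sum[OF supp] one by auto
    then have "support K l \<in> K" using sub supp by blast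
    moreover have "l \<in> \<Union>K \<rightarrow>\<^sub>E {0..}"
    proof (rule PiE_I)
      show "l v \<in> {0..}" if "v \<in> \<Union>K" for v using lv[OF that] by (auto split: if_splits)
      show "l v = undefined" if "v \<notin> \<Union>K" for v using PiE_arb[OF B that] .
    qed
    ultimately show "l \<in> closed_simplex K \<sigma>"
      using supp sum[OF supp] one by (simp add: closed_simplex_def realization_def)
  qed
qed

text \<open>The simplex is cut out by a closed linear condition from a product of compact factors
  \<open>[0, 1]\<close> and \<open>{0}\<close>, which is compact by Tychonoff.\<close>

lemma compactin_closed_simplex:
  assumes \<sigma>: "\<sigma> \<in> K" "finite \<sigma>" and sub: "\<And>\<tau>. \<tau> \<subseteq> \<sigma> \<Longrightarrow> \<tau> \<noteq> {} \<Longrightarrow> \<tau> \<in> K"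
  shows "compactin (powertop_real (\<Union>K)) (closed_simplex K \<sigma>)"
proof -
  have "continuous_map (powertop_real (\<Union>K)) euclideanreal (\<lambda>l. \<Sum>v\<in>\<sigma>. l v)"
    by (intro continuous_map_sum continuous_map_product_projection) (use \<sigma> in auto)
  then have "closedin (powertop_real (\<Union>K)) {l \<in> topspace (powertop_real (\<Union>K)). (\<Sum>v\<in>\<sigma>. l v) \<in> {1}}"
    by (rule closedin_continuous_map_preimage) simp
  moreover have "compactin (powertop_real (\<Union>K)) (\<Pi>\<^sub>E v\<in>\<Union>K. if v \<in> \<sigma> then {0..1} else {0})"
    by (simp add: compactin_PiE)
  ultimately have "compactin (powertop_real (\<Union>K))
      ({l \<in> topspace (powertop_real (\<Union>K)). (\<Sum>v\<in>\<sigma>. l v) \<in> {1}} \<inter>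
        (\<Pi>\<^sub>E v\<in>\<Union>K. if v \<in> \<sigma> then {0..1} else {0}))"
    by (rule closed_Int_compactin)
  moreover have "closed_simplex K \<sigma> = {l \<in> \<Union>K \<rightarrow>\<^sub>E UNIV. (\<Sum>v\<in>\<sigma>. l v) \<in> {1}} \<inter>
      (\<Pi>\<^sub>E v\<in>\<Union>K. if v \<in> \<sigma> then {0..1} else {0})"
    by (rule closed_simplex_eq[OF \<sigma>]) (rule sub)
  ultimately show ?thesis by simp
qed

lemma realization_subset_topspace: "realization K \<subseteq> topspace (powertop_real (\<Union>K))"
proof -
  have "(\<Union>K \<rightarrow>\<^sub>E {0..}) \<subseteq> (\<Union>K \<rightarrow>\<^sub>E (UNIV :: real set))" by (rule PiE_mono) simp
  then show ?thesis by (auto simp: realization_def)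
qed

lemma closed_simplex_subset_realization: "closed_simplex K \<sigma> \<subseteq> realization K"
  by (auto simp: closed_simplex_def)

lemma Union_closed_simplices: "\<Union>(closed_simplex K ` K) = realization K"
  by (auto simp: closed_simplex_def realization_def)

section \<open>Homeomorphy on each closed simplex and on the whole\<close>

context integer_valuated_matroid
begin

text \<open>The support varies within a closed simplex; a formula over the fixed set
  \<open>S\<close> makes continuity accessible.\<close>

lemma affine_extension_on_simplex:
  assumes S: "S \<subseteq> normalized" "finite S" and l: "l \<in> closed_simplex K (cls ` S)"
  shows "affine_extension E K l = line_rel E `` {combination E S (\<lambda>s. l (cls s))}"
proof (rule affine_extension_eq[OF S])
  show "support K l \<subseteq> cls ` S" using l by (simp add: closed_simplex_def)
  fix s assume "s \<in> S" "cls s \<notin> support K l"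
  moreover have "cls s \<in> \<Union>K" unfolding vertices using \<open>s \<in> S\<close> S(1) by auto
  ultimately show "l (cls s) = 0" unfolding support_def by (simp del: Union_iff)
qed

text \<open>A continuous bijection from a compact space onto a Hausdorff space is a
  homeomorphism.\<close>

lemma homeomorphic_map_closed_simplex:
  assumes \<sigma>: "\<sigma> \<in> K"
  shows "homeomorphic_map (subtopology (powertop_real (\<Union>K)) (closed_simplex K \<sigma>))
    (subtopology (quotient_topology (powertop_real E) (line_rel E)) (affine_extension E K ` closed_simplex K \<sigma>))
    (affine_extension E K)" (is "homeomorphic_map ?X ?Y ?\<phi>")
proof (rule continuous_imp_homeomorphic_map)
  let ?Q = "quotient_topology (powertop_real E) (line_rel E)"
  obtain S where S: "S \<subseteq> normalized" "finite S" and \<sigma>S: "\<sigma> = cls ` S"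
    using \<sigma> unfolding building_iff by blast
  have "compactin (powertop_real (\<Union>K)) (closed_simplex K \<sigma>)"
    by (rule compactin_closed_simplex[OF \<sigma>]) (use S \<sigma>S building_subset[OF \<sigma>] in auto)
  then show "compact_space ?X" by (rule compact_space_subtopology)
  show "Hausdorff_space ?Y" by (intro Hausdorff_space_subtopology Hausdorff_space_line_quotient)
  have real: "closed_simplex K \<sigma> \<subseteq> realization K" by (rule closed_simplex_subset_realization)
  then have topX: "topspace ?X = closed_simplex K \<sigma>"
    using realization_subset_topspace[of K] by auto
  have "?\<phi> ` closed_simplex K \<sigma> \<subseteq> T // line_rel E"
    using bij_betw_affine_extension real unfolding bij_betw_def by blast
  also have "T // line_rel E \<subseteq> topspace ?Q"
    unfolding topspace_quotient_topology[OF equiv_line_rel] using tropical_PiE by (auto simp: quotient_def)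
  finally have topY: "topspace ?Y = ?\<phi> ` closed_simplex K \<sigma>" by auto
  show "?\<phi> ` topspace ?X = topspace ?Y" unfolding topX topY ..
  show "inj_on ?\<phi> (topspace ?X)"
    unfolding topX by (rule inj_on_subset[OF inj_on_affine_extension real])
  \<comment> \<open>The map lifts to \<open>\<real>\<^sup>E\<close>, where each coordinate is a
    finite linear expression in the barycentric coordinates; the projection is continuous.\<close>
  have "continuous_map ?X (powertop_real E) (\<lambda>l. combination E S (\<lambda>s. l (cls s)))"
    unfolding continuous_map_componentwise
  proof (intro conjI ballI)
    fix e assume e: "e \<in> E"
    have "cls s \<in> \<Union>K" if "s \<in> S" for s unfolding vertices using that S(1) by auto
    then have "continuous_map ?X euclideanreal (\<lambda>l. \<Sum>s\<in>S. l (cls s) * s e)"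
      by (intro continuous_map_sum S(2) continuous_map_real_mult continuous_map_from_subtopology
          continuous_map_product_projection) simp_all
    then show "continuous_map ?X euclideanreal (\<lambda>l. combination E S (\<lambda>s. l (cls s)) e)"
      using e by (simp add: combination_def)
  qed (auto simp: combination_def)
  then have "continuous_map ?X ?Q ((\<lambda>x. line_rel E `` {x}) \<circ> (\<lambda>l. combination E S (\<lambda>s. l (cls s))))"
    by (rule continuous_map_compose)
      (rule quotient_imp_continuous_map[OF quotient_map_quotient_topology[OF equiv_line_rel]])
  then have "continuous_map ?X ?Q ?\<phi>"
    by (rule continuous_map_eq) (use affine_extension_on_simplex[OF S] topX \<sigma>S in auto)
  then show "continuous_map ?X ?Y ?\<phi>"
    using topX by (simp add: continuous_map_in_subtopology)
qed

lemma geometric_realization_building: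
  "geometric_realization K (quotient_topology (powertop_real E) (line_rel E)) (T // line_rel E)
     (affine_extension E K)"
  unfolding geometric_realization_def
proof (intro conjI ballI bij_betw_affine_extension homeomorphic_map_closed_simplex
    homeomorphic_map_coherent_topology)
  show "inj_on (affine_extension E K) (\<Union>(closed_simplex K ` K))"
    unfolding Union_closed_simplices by (rule inj_on_affine_extension)
  fix \<sigma> assume \<sigma>: "\<sigma> \<in> K"
  show "closed_simplex K \<sigma> \<subseteq> topspace (powertop_real (\<Union>K))"
    using closed_simplex_subset_realization realization_subset_topspace by (rule subset_trans)
  have "affine_extension E K ` closed_simplex K \<sigma> \<subseteq> T // line_rel E"
    using bij_betw_affine_extension closed_simplex_subset_realization unfolding bij_betw_def by blast
  also have "\<dots> \<subseteq> topspace (quotient_topology (powertop_real E) (line_rel E))"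
    unfolding topspace_quotient_topology[OF equiv_line_rel] using tropical_PiE by (auto simp: quotient_def)
  finally show "affine_extension E K ` closed_simplex K \<sigma>
    \<subseteq> topspace (quotient_topology (powertop_real E) (line_rel E))" .
qed

end

theorem theorem5p3:
  fixes n :: nat and E :: "'a set" and \<B> :: "'a set set" and \<omega> :: "'a set \<Rightarrow> real"
  assumes "modular_valuated_matroid n E \<B> \<omega>"
  shows "geometric_realization
           (euclidean_building (tropical_lattice E \<B> \<omega>))
           (quotient_topology (powertop_real E) (line_rel E))
           (tropical_linear_space E \<B> \<omega> // line_rel E)
           (affine_extension E (euclidean_building (tropical_lattice E \<B> \<omega>)))"
proof -
  interpret integer_valuated_matroid n E \<B> \<omega>
    by standard (use assms in \<open>auto simp: modular_valuated_matroid_def\<close>)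
  show ?thesis by (rule geometric_realization_building)
qed

end
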